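(* Any finite index subgroup $H\subset\Gamma=PSL(2,\mathbb Z)$ is a free product $$H\cong \circledast_{n_0}\mathbb Z\ *\ \circledast_{n_2}\mathbb Z_2\ *\ \circledast_{n_3}\mathbb Z_3$$ for some integers $n_0,n_2,n_3\ge0$, and one has $[\Gamma:H]=6n_0+3n_2+4n_3-6$.
   Context: $\circledast_nG$ denotes the free product of $n$ copies of $G$; $\mathbb Z_m$ is the cyclic group of order $m$. *)

theory Defs
  imports "HOL-Algebra.Elementary_Groups" "HOL-Analysis.Determinants"
begin

section \<open>Free products of groups\<close>

text \<open>
  The free product of a family of groups is the set of words in the disjoint union of the
  factors, modulo the congruence generated by deleting identity letters and by multiplying
  adjacent letters of the same factor; the multiplication is induced by concatenation.
\<close>

definition free_product_words :: "'i set \<Rightarrow> ('i \<Rightarrow> ('a, 'b) monoid_scheme) \<Rightarrow> ('i \<times> 'a) list set"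
  where "free_product_words I G = lists (SIGMA i:I. carrier (G i))"

inductive free_product_equiv ::
  "'i set \<Rightarrow> ('i \<Rightarrow> ('a, 'b) monoid_scheme) \<Rightarrow> ('i \<times> 'a) list \<Rightarrow> ('i \<times> 'a) list \<Rightarrow> bool"
  for I G where
  refl: "w \<in> free_product_words I G \<Longrightarrow> free_product_equiv I G w w"
| sym: "free_product_equiv I G u v \<Longrightarrow> free_product_equiv I G v u"
| trans: "\<lbrakk>free_product_equiv I G u v; free_product_equiv I G v w\<rbrakk> \<Longrightarrow> free_product_equiv I G u w"
| unit: "\<lbrakk>u \<in> free_product_words I G; v \<in> free_product_words I G; i \<in> I\<rbrakk>
    \<Longrightarrow> free_product_equiv I G (u @ [(i, \<one>\<^bsub>G i\<^esub>)] @ v) (u @ v)"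
| merge: "\<lbrakk>u \<in> free_product_words I G; v \<in> free_product_words I G; i \<in> I;
      x \<in> carrier (G i); y \<in> carrier (G i)\<rbrakk>
    \<Longrightarrow> free_product_equiv I G (u @ [(i, x), (i, y)] @ v) (u @ [(i, x \<otimes>\<^bsub>G i\<^esub> y)] @ v)"

definition free_product_rel ::
  "'i set \<Rightarrow> ('i \<Rightarrow> ('a, 'b) monoid_scheme) \<Rightarrow> (('i \<times> 'a) list \<times> ('i \<times> 'a) list) set"
  where "free_product_rel I G = {(u, v). free_product_equiv I G u v}"

definition free_product ::
  "'i set \<Rightarrow> ('i \<Rightarrow> ('a, 'b) monoid_scheme) \<Rightarrow> ('i \<times> 'a) list set monoid"
  where "free_product I G =
    \<lparr>carrier = free_product_words I G // free_product_rel I G,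
     monoid.mult = (\<lambda>A B. \<Union>u\<in>A. \<Union>v\<in>B. free_product_rel I G `` {u @ v}),
     one = free_product_rel I G `` {[]}\<rparr>"

definition free_copies :: "nat \<Rightarrow> ('a, 'b) monoid_scheme \<Rightarrow> (nat \<times> 'a) list set monoid"
  where "free_copies n G = free_product {..<n} (\<lambda>_. G)"

text \<open>The free product of a finite list of groups with a common element type.\<close>

definition free_product_list :: "('a, 'b) monoid_scheme list \<Rightarrow> (nat \<times> 'a) list set monoid"
  where "free_product_list Gs = free_product {..<length Gs} (\<lambda>i. Gs ! i)"

subsection \<open>The free product is a group\<close>

lemma free_product_words_append [simp]:
  "u @ v \<in> free_product_words I G \<longleftrightarrow> u \<in> free_product_words I G \<and> v \<in> free_product_words I G"
  by (simp add: free_product_words_def)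

lemma free_product_words_Nil [simp]: "[] \<in> free_product_words I G"
  by (simp add: free_product_words_def)

lemma free_product_words_Cons [simp]:
  "p # v \<in> free_product_words I G \<longleftrightarrow>
    fst p \<in> I \<and> snd p \<in> carrier (G (fst p)) \<and> v \<in> free_product_words I G"
  by (cases p) (auto simp: free_product_words_def)

lemma free_product_equiv_words:
  assumes "\<forall>i\<in>I. group (G i)" and "free_product_equiv I G u v"
  shows "u \<in> free_product_words I G \<and> v \<in> free_product_words I G"
  using assms(2)
  by induction (use assms(1) in \<open>auto simp: group.is_monoid monoid.m_closed monoid.one_closed\<close>)

lemma equiv_free_product_rel:
  assumes "\<forall>i\<in>I. group (G i)"
  shows "equiv (free_product_words I G) (free_product_rel I G)"
proof (rule equivI)
  show "free_product_rel I G \<subseteq> free_product_words I G \<times> free_product_words I G"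
    using free_product_equiv_words[of I G] assms unfolding free_product_rel_def by blast
  show "refl_on (free_product_words I G) (free_product_rel I G)"
    using free_product_equiv.refl unfolding free_product_rel_def by (auto intro!: refl_onI)
  show "sym (free_product_rel I G)"
    using free_product_equiv.sym unfolding free_product_rel_def by (auto intro!: symI)
  show "trans (free_product_rel I G)"
    using free_product_equiv.trans unfolding free_product_rel_def by (blast intro!: transI)
qed

lemma free_product_equiv_append:
  assumes "\<forall>i\<in>I. group (G i)"
    and "free_product_equiv I G u u'" and "free_product_equiv I G v v'"
  shows "free_product_equiv I G (u @ v) (u' @ v')"
proof -
  have left: "free_product_equiv I G (w @ v) (w @ v')" if "w \<in> free_product_words I G" for w
    using assms(3)
  proof induction
    case (unit a b i)
    then show ?case
      using free_product_equiv.unit[of "w @ a" I G b i] that by simp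
  next
    case (merge a b i x y)
    then show ?case
      using free_product_equiv.merge[of "w @ a" I G b i x y] that by simp
  next
    case (refl a)
    then show ?case
      using that by (simp add: free_product_equiv.refl)
  next
    case (sym a b)
    show ?case
      using sym.IH by (rule free_product_equiv.sym)
  next
    case (trans a b c)
    show ?case
      using trans.IH by (rule free_product_equiv.trans)
  qed
  have right: "free_product_equiv I G (u @ w) (u' @ w)" if "w \<in> free_product_words I G" for w
    using assms(2)
  proof induction
    case (unit a b i)
    then show ?case
      using free_product_equiv.unit[of a I G "b @ w" i] that by simp
  next
    case (merge a b i x y)
    then show ?case
      using free_product_equiv.merge[of a I G "b @ w" i x y] that by simp
  next
    case (refl a)
    then show ?case
      using that by (simp add: free_product_equiv.refl)
  next
    case (sym a b)
    show ?case
      using sym.IH by (rule free_product_equiv.sym)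
  next
    case (trans a b c)
    show ?case
      using trans.IH by (rule free_product_equiv.trans)
  qed
  show ?thesis
    using left[of u] right[of v'] free_product_equiv_words[of I G, OF assms(1)] assms(2,3)
    by (metis free_product_equiv.trans)
qed

lemma free_product_mult_class:
  assumes "\<forall>i\<in>I. group (G i)"
    and "u \<in> free_product_words I G" and "v \<in> free_product_words I G"
  shows "free_product_rel I G `` {u} \<otimes>\<^bsub>free_product I G\<^esub> free_product_rel I G `` {v} =
    free_product_rel I G `` {u @ v}"
proof -
  let ?R = "free_product_rel I G"
  have eq: "equiv (free_product_words I G) ?R"
    using assms(1) by (rule equiv_free_product_rel)
  have cls: "?R `` {a @ b} = ?R `` {u @ v}" if "a \<in> ?R `` {u}" "b \<in> ?R `` {v}" for a b
  proof -
    have "free_product_equiv I G u a" "free_product_equiv I G v b"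
      using that by (simp_all add: free_product_rel_def)
    then have "free_product_equiv I G (u @ v) (a @ b)"
      by (rule free_product_equiv_append[of I G, OF assms(1)])
    then have "(u @ v, a @ b) \<in> ?R"
      by (simp add: free_product_rel_def)
    then show ?thesis
      by (rule equiv_class_eq[OF eq, symmetric])
  qed
  have ne: "?R `` {u} \<noteq> {}" "?R `` {v} \<noteq> {}"
    using equiv_class_self[OF eq] assms(2,3) by blast+
  have "(\<Union>a\<in>?R `` {u}. \<Union>b\<in>?R `` {v}. ?R `` {a @ b}) =
      (\<Union>a\<in>?R `` {u}. \<Union>b\<in>?R `` {v}. ?R `` {u @ v})"
    by (intro SUP_cong HOL.refl cls)
  also have "\<dots> = ?R `` {u @ v}"
    using ne by simp
  finally show ?thesis
    by (simp add: free_product_def)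
qed

lemma carrier_free_product:
  "carrier (free_product I G) = (\<lambda>w. free_product_rel I G `` {w}) ` free_product_words I G"
  by (auto simp: free_product_def quotient_def)

lemma one_free_product: "\<one>\<^bsub>free_product I G\<^esub> = free_product_rel I G `` {[]}"
  by (simp add: free_product_def)

lemma free_product_left_inverse:
  assumes "\<forall>i\<in>I. group (G i)" and "w \<in> free_product_words I G"
  shows "\<exists>w'\<in>free_product_words I G. free_product_equiv I G (w' @ w) []"
  using assms(2)
proof (induction w)
  case Nil
  then show ?case
    by (intro bexI[of _ "[]"]) (auto intro: free_product_equiv.refl)
next
  case (Cons p w)
  obtain i x where p: "p = (i, x)"
    by fastforce
  have ix: "i \<in> I" "x \<in> carrier (G i)" and w: "w \<in> free_product_words I G"
    using Cons.prems p by auto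
  interpret Gi: group "G i"
    using assms(1) ix by blast
  obtain w' where w': "w' \<in> free_product_words I G" "free_product_equiv I G (w' @ w) []"
    using Cons.IH[OF w] by blast
  let ?y = "inv\<^bsub>G i\<^esub> x"
  have "free_product_equiv I G (w' @ [(i, ?y), (i, x)] @ w) (w' @ [(i, ?y \<otimes>\<^bsub>G i\<^esub> x)] @ w)"
    using w'(1) w ix by (intro free_product_equiv.merge) auto
  moreover have "free_product_equiv I G (w' @ [(i, ?y \<otimes>\<^bsub>G i\<^esub> x)] @ w) (w' @ w)"
    using w'(1) w ix free_product_equiv.unit[of w' I G w i] by simp
  ultimately have "free_product_equiv I G ((w' @ [(i, ?y)]) @ p # w) []"
    using w'(2) p free_product_equiv.trans by (metis append.assoc append_Cons append_Nil)
  moreover have "w' @ [(i, ?y)] \<in> free_product_words I G"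
    using w'(1) ix by simp
  ultimately show ?case
    by blast
qed

lemma group_free_product:
  assumes "\<forall>i\<in>I. group (G i)"
  shows "group (free_product I G)"
proof (rule groupI)
  note mult = free_product_mult_class[of I G, OF assms]
  show "x \<otimes>\<^bsub>free_product I G\<^esub> y \<in> carrier (free_product I G)"
    if "x \<in> carrier (free_product I G)" "y \<in> carrier (free_product I G)" for x y
    using that by (fastforce simp: carrier_free_product mult)
  show "\<one>\<^bsub>free_product I G\<^esub> \<in> carrier (free_product I G)"
    by (auto simp: carrier_free_product one_free_product)
  show "x \<otimes>\<^bsub>free_product I G\<^esub> y \<otimes>\<^bsub>free_product I G\<^esub> z =
      x \<otimes>\<^bsub>free_product I G\<^esub> (y \<otimes>\<^bsub>free_product I G\<^esub> z)"
    if "x \<in> carrier (free_product I G)" "y \<in> carrier (free_product I G)"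
      "z \<in> carrier (free_product I G)" for x y z
    using that by (fastforce simp: carrier_free_product mult)
  show "\<one>\<^bsub>free_product I G\<^esub> \<otimes>\<^bsub>free_product I G\<^esub> x = x"
    if "x \<in> carrier (free_product I G)" for x
    using that by (auto simp: carrier_free_product one_free_product mult)
  show "\<exists>y\<in>carrier (free_product I G). y \<otimes>\<^bsub>free_product I G\<^esub> x = \<one>\<^bsub>free_product I G\<^esub>"
    if x: "x \<in> carrier (free_product I G)" for x
  proof -
    obtain w where w: "w \<in> free_product_words I G" "x = free_product_rel I G `` {w}"
      using x by (auto simp: carrier_free_product)
    obtain w' where w': "w' \<in> free_product_words I G" "free_product_equiv I G (w' @ w) []"
      using free_product_left_inverse[of I G, OF assms w(1)] by blast
    have "free_product_rel I G `` {w' @ w} = free_product_rel I G `` {[]}"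
      using w'(2) by (intro equiv_class_eq[OF equiv_free_product_rel[of I G, OF assms]])
        (simp_all add: free_product_rel_def)
    then have "free_product_rel I G `` {w'} \<otimes>\<^bsub>free_product I G\<^esub> x = \<one>\<^bsub>free_product I G\<^esub>"
      using w w'(1) by (simp add: one_free_product mult)
    then show ?thesis
      using w'(1) by (auto simp: carrier_free_product)
  qed
qed

subsection \<open>The universal property\<close>

definition free_product_incl ::
  "'i set \<Rightarrow> ('i \<Rightarrow> ('a, 'b) monoid_scheme) \<Rightarrow> 'i \<Rightarrow> 'a \<Rightarrow> ('i \<times> 'a) list set"
  where "free_product_incl I G i x = free_product_rel I G `` {[(i, x)]}"

lemma free_product_incl_hom:
  assumes "\<forall>i\<in>I. group (G i)" and "i \<in> I"
  shows "free_product_incl I G i \<in> hom (G i) (free_product I G)"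
proof (rule homI)
  show "free_product_incl I G i x \<in> carrier (free_product I G)" if "x \<in> carrier (G i)" for x
    using that assms(2) by (auto simp: carrier_free_product free_product_incl_def)
  show "free_product_incl I G i (x \<otimes>\<^bsub>G i\<^esub> y) =
      free_product_incl I G i x \<otimes>\<^bsub>free_product I G\<^esub> free_product_incl I G i y"
    if xy: "x \<in> carrier (G i)" "y \<in> carrier (G i)" for x y
  proof -
    have "free_product_equiv I G [(i, x), (i, y)] [(i, x \<otimes>\<^bsub>G i\<^esub> y)]"
      using free_product_equiv.merge[of "[]" I G "[]" i x y] xy assms(2) by simp
    then have "free_product_rel I G `` {[(i, x), (i, y)]} =
        free_product_rel I G `` {[(i, x \<otimes>\<^bsub>G i\<^esub> y)]}"
      by (intro equiv_class_eq[OF equiv_free_product_rel[of I G, OF assms(1)]])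
        (simp_all add: free_product_rel_def)
    moreover have "free_product_incl I G i x \<otimes>\<^bsub>free_product I G\<^esub> free_product_incl I G i y =
        free_product_rel I G `` {[(i, x)] @ [(i, y)]}"
      unfolding free_product_incl_def
      by (rule free_product_mult_class) (use xy assms in auto)
    ultimately show ?thesis
      by (simp add: free_product_incl_def)
  qed
qed

definition word_lift :: "('c, 'd) monoid_scheme \<Rightarrow> ('i \<Rightarrow> 'a \<Rightarrow> 'c) \<Rightarrow> ('i \<times> 'a) list \<Rightarrow> 'c"
  where "word_lift K f w = foldr (\<lambda>(i, x) z. f i x \<otimes>\<^bsub>K\<^esub> z) w \<one>\<^bsub>K\<^esub>"

lemma word_lift_simps [simp]:
  "word_lift K f [] = \<one>\<^bsub>K\<^esub>"
  "word_lift K f ((i, x) # w) = f i x \<otimes>\<^bsub>K\<^esub> word_lift K f w"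
  by (simp_all add: word_lift_def)

lemma free_product_universal:
  assumes G: "\<forall>i\<in>I. group (G i)" and K: "group K"
    and f: "\<And>i. i \<in> I \<Longrightarrow> f i \<in> hom (G i) K"
  shows "\<exists>h\<in>hom (free_product I G) K.
      (\<forall>i\<in>I. \<forall>x\<in>carrier (G i). h (free_product_incl I G i x) = f i x) \<and>
      (\<forall>h'\<in>hom (free_product I G) K.
        (\<forall>i\<in>I. \<forall>x\<in>carrier (G i). h' (free_product_incl I G i x) = f i x) \<longrightarrow>
        (\<forall>z\<in>carrier (free_product I G). h' z = h z))"
proof -
  interpret K: group K by (rule K)
  let ?R = "free_product_rel I G" and ?L = "word_lift K f"
  note mult = free_product_mult_class[of I G, OF G]
  have fc: "f i x \<in> carrier K" if "i \<in> I" "x \<in> carrier (G i)" for i x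
    using f that by (auto simp: hom_def)
  have Lc: "?L w \<in> carrier K" if "w \<in> free_product_words I G" for w
    using that by (induction w) (auto simp: fc)
  have La: "?L (u @ v) = ?L u \<otimes>\<^bsub>K\<^esub> ?L v"
    if "u \<in> free_product_words I G" "v \<in> free_product_words I G" for u v
    using that(1) by (induction u) (auto simp: fc Lc that(2) K.m_assoc)
  have Leq: "?L u = ?L v" if "free_product_equiv I G u v" for u v
    using that
  proof induction
    case (unit u v i)
    interpret Gi: group "G i" using G unit by blast
    have "f i \<one>\<^bsub>G i\<^esub> = \<one>\<^bsub>K\<^esub>"
      using f[OF \<open>i \<in> I\<close>] hom_one[of "f i" "G i" K] Gi.group_axioms K by blast
    then show ?case
      using unit by (simp add: La Lc)
  next
    case (merge u v i x y)
    interpret Gi: group "G i" using G merge by blast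
    have "f i (x \<otimes>\<^bsub>G i\<^esub> y) = f i x \<otimes>\<^bsub>K\<^esub> f i y"
      using f[OF \<open>i \<in> I\<close>] merge by (simp add: hom_mult)
    then show ?case
      using merge by (simp add: La Lc fc K.m_assoc)
  qed auto
  define h where "h A = ?L (SOME w. w \<in> A)" for A
  have h: "h (?R `` {w}) = ?L w" if "w \<in> free_product_words I G" for w
  proof -
    have "w \<in> ?R `` {w}"
      using that by (auto simp: free_product_rel_def intro: free_product_equiv.refl)
    then have "(SOME a. a \<in> ?R `` {w}) \<in> ?R `` {w}"
      by (metis someI)
    then have "free_product_equiv I G w (SOME a. a \<in> ?R `` {w})"
      by (simp add: free_product_rel_def)
    then show ?thesis
      unfolding h_def using Leq by metis
  qed
  have hh: "h \<in> hom (free_product I G) K"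
    by (rule homI) (auto simp: carrier_free_product h Lc La mult)
  have hi: "h (free_product_incl I G i x) = f i x" if "i \<in> I" "x \<in> carrier (G i)" for i x
    using that by (simp add: free_product_incl_def h fc)
  have uniq: "h' z = h z"
    if h': "h' \<in> hom (free_product I G) K"
      and eq: "\<And>i x. i \<in> I \<Longrightarrow> x \<in> carrier (G i) \<Longrightarrow> h' (free_product_incl I G i x) = f i x"
      and z: "z \<in> carrier (free_product I G)" for h' z
  proof -
    have "h' (?R `` {w}) = ?L w" if "w \<in> free_product_words I G" for w
      using that
    proof (induction w)
      case Nil
      then show ?case
        using hom_one[OF h' group_free_product[of I G, OF G] K] by (simp add: one_free_product)
    next
      case (Cons p w)
      obtain i x where p: "p = (i, x)"
        by fastforce
      have "h' (?R `` {[p] @ w}) = h' (?R `` {[p]} \<otimes>\<^bsub>free_product I G\<^esub> ?R `` {w})"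
        using Cons.prems by (subst mult) auto
      also have "\<dots> = h' (?R `` {[p]}) \<otimes>\<^bsub>K\<^esub> h' (?R `` {w})"
        using Cons.prems by (intro hom_mult[OF h']) (auto simp: carrier_free_product)
      also have "\<dots> = ?L (p # w)"
        using Cons p eq[of i x] by (simp add: free_product_incl_def)
      finally show ?case
        by simp
    qed
    then show ?thesis
      using z h by (auto simp: carrier_free_product)
  qed
  show ?thesis
    using hh hi uniq by blast
qed

section \<open>The modular group\<close>

definition SL2Z :: "(int ^ 2 ^ 2) monoid"
  where "SL2Z = \<lparr>carrier = {A. det A = 1}, monoid.mult = (**), one = mat 1\<rparr>"

definition PSL2Z :: "(int ^ 2 ^ 2) set monoid"
  where "PSL2Z = SL2Z Mod {mat 1, - mat 1}"

lemma group_SL2Z: "group SL2Z"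
proof (rule groupI)
  show "\<exists>B\<in>carrier SL2Z. B \<otimes>\<^bsub>SL2Z\<^esub> A = \<one>\<^bsub>SL2Z\<^esub>" if "A \<in> carrier SL2Z" for A
  proof -
    let ?B = "vector [vector [A$2$2, - A$1$2], vector [- A$2$1, A$1$1]] :: int ^ 2 ^ 2"
    have "det ?B = 1" "?B ** A = mat 1"
      using that
      by (auto simp: SL2Z_def det_2 vec_eq_iff forall_2 matrix_matrix_mult_def sum_2 mat_def
          algebra_simps)
    then show ?thesis
      unfolding SL2Z_def by auto
  qed
qed (auto simp: SL2Z_def det_mul matrix_mul_assoc)

lemma normal_pm_one_SL2Z: "{mat 1, - mat 1} \<lhd> SL2Z"
proof -
  interpret group SL2Z by (rule group_SL2Z)
  have comm: "- mat 1 ** A = A ** - mat 1" for A :: "int ^ 2 ^ 2"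
    by (auto simp: vec_eq_iff forall_2 matrix_matrix_mult_def sum_2 mat_def)
  have sq: "- mat 1 ** - mat 1 = (mat 1 :: int ^ 2 ^ 2)"
    by (auto simp: vec_eq_iff forall_2 matrix_matrix_mult_def sum_2 mat_def)
  have det: "det (- mat 1 :: int ^ 2 ^ 2) = 1"
    by (simp add: det_2 mat_def)
  have inv: "inv\<^bsub>SL2Z\<^esub> (- mat 1) = - mat 1"
    by (rule inv_equality) (simp_all add: SL2Z_def sq det)
  have inv1: "inv\<^bsub>SL2Z\<^esub> (mat 1) = mat 1"
    by (rule inv_equality) (simp_all add: SL2Z_def)
  have "subgroup {mat 1, - mat 1} SL2Z"
    by (rule subgroupI) (auto simp: SL2Z_def[THEN arg_cong[where f = carrier]]
        SL2Z_def[THEN arg_cong[where f = monoid.mult]] inv inv1 sq det)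
  moreover have "{mat 1, - mat 1} #>\<^bsub>SL2Z\<^esub> A = A <#\<^bsub>SL2Z\<^esub> {mat 1, - mat 1}" for A
    by (auto simp: r_coset_def l_coset_def SL2Z_def comm)
  ultimately show ?thesis
    by (intro normalI) auto
qed

lemma group_PSL2Z: "group PSL2Z"
  unfolding PSL2Z_def using normal_pm_one_SL2Z by (rule normal.factorgroup_is_group)

end

theory Submission
  imports Defs
begin

text \<open>
  The group \<open>\<Gamma> = PSL(2, \<int>)\<close> is the free product of the group of order 2 generated by
  \<open>S = (0, -1; 1, 0)\<close> and the group of order 3 generated by \<open>U = (0, 1; -1, -1)\<close>. Euclid's
  algorithm on the first column shows that these elements generate. There are no further relations:
  after cancelling squares of \<open>S\<close> and cubes of \<open>U\<close>, a word is
  \<open>U\<^sup>e\<close>, then a product of blocks \<open>SU\<close> and \<open>SU\<^sup>2\<close>, then a power of \<open>S\<close>;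
  up to sign the blocks are \<open>(1, 1; 0, 1)\<close> and \<open>(1, 0; 1, 1)\<close>, so their products have
  nonnegative entries that grow, and only the empty word has value \<open>\<plusminus>1\<close>.

  For a subgroup \<open>H\<close> of finite index, consider the bipartite graph whose edges are the right cosets
  of \<open>H\<close>, and whose two kinds of vertices are the orbits of \<open>S\<close> and of \<open>U\<close> acting on
  the cosets by right multiplication; an edge joins the two orbits that contain it. It is the
  quotient by \<open>H\<close> of the tree on which \<open>\<Gamma>\<close> acts. The graph is connected, so it has a
  spanning tree \<open>T\<close>. The free factors of \<open>H\<close> are one copy of \<open>\<int>\<close> for every edge
  outside \<open>T\<close>, one copy of \<open>\<int>\<^sub>2\<close> for every coset fixed by \<open>S\<close> and one copy of
  \<open>\<int>\<^sub>3\<close> for every coset fixed by \<open>U\<close>. The index formula is the statement that a tree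
  has one more vertex than it has edges.

  The isomorphism is obtained by writing down both directions instead of rewriting words in
  \<open>H\<close>. Let \<open>F\<close> be the free product with these generators. As \<open>S\<close> and \<open>U\<close> satisfy
  no relations but the obvious ones, a function \<open>C(x, g)\<close> on cosets and group elements with values
  in \<open>F\<close> and \<open>C(x, g h) = C(x, g) C(x g, h)\<close> may be prescribed freely at \<open>g = S\<close> and
  \<open>g = U\<close>, up to one condition for each (\<open>cocycle_extension\<close>). On \<open>H\<close>, which fixes the
  coset \<open>H\<close>, the function \<open>C(H, -)\<close> is a homomorphism to \<open>F\<close>. Conversely, representatives
  of the cosets that are compatible along \<open>T\<close> (\<open>tree_sections\<close>) define elements of
  \<open>H\<close>, hence a homomorphism from \<open>F\<close> to \<open>H\<close> by the universal property. The two maps are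
  inverse to each other; each half is checked by propagating an identity along generators or along
  the tree (\<open>subgroup_iso_of_tree\<close>).
\<close>

section \<open>Words in two generators of orders 2 and 3\<close>

datatype letter = Inv | Rot

primrec word_value :: "('a, 'b) monoid_scheme \<Rightarrow> 'a \<Rightarrow> 'a \<Rightarrow> letter list \<Rightarrow> 'a" where
  "word_value K s u [] = \<one>\<^bsub>K\<^esub>"
| "word_value K s u (l # w) = case_letter s u l \<otimes>\<^bsub>K\<^esub> word_value K s u w"

text \<open>
  Cancellation goes in one direction only. This is enough: the words of interest cancel to a normal
  form or to the empty word, and every invariant of a word that respects the two relations is
  proved invariant by one rule induction.
\<close>

inductive cancels :: "letter list \<Rightarrow> letter list \<Rightarrow> bool" where
  refl: "cancels w w"
| inv: "cancels w (p @ [Inv, Inv] @ q) \<Longrightarrow> cancels w (p @ q)"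
| rot: "cancels w (p @ [Rot, Rot, Rot] @ q) \<Longrightarrow> cancels w (p @ q)"

lemma cancels_Cons: "cancels w w' \<Longrightarrow> cancels (l # w) (l # w')"
proof (induction rule: cancels.induct)
  case (inv w p q)
  then show ?case
    using cancels.inv[of "l # w" "l # p" q] by simp
next
  case (rot w p q)
  then show ?case
    using cancels.rot[of "l # w" "l # p" q] by simp
qed (rule cancels.refl)

lemma word_value_append:
  assumes "group K" "a \<in> carrier K" "b \<in> carrier K"
  shows "word_value K a b v \<in> carrier K"
    and "word_value K a b (v @ w) = word_value K a b v \<otimes>\<^bsub>K\<^esub> word_value K a b w"
proof -
  interpret K: group K by fact
  have closed: "word_value K a b v \<in> carrier K" for v
    using assms(2,3) by (induction v) (auto split: letter.split)
  then show "word_value K a b v \<in> carrier K" .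
  show "word_value K a b (v @ w) = word_value K a b v \<otimes>\<^bsub>K\<^esub> word_value K a b w"
    using assms(2,3) by (induction v) (auto split: letter.split simp: closed K.m_assoc)
qed

lemma cancels_word_value:
  assumes K: "group K" "a \<in> carrier K" "b \<in> carrier K"
    and rel: "a \<otimes>\<^bsub>K\<^esub> a = \<one>\<^bsub>K\<^esub>" "b \<otimes>\<^bsub>K\<^esub> b \<otimes>\<^bsub>K\<^esub> b = \<one>\<^bsub>K\<^esub>"
    and "cancels v w"
  shows "word_value K a b v = word_value K a b w"
proof -
  interpret K: group K by fact
  note app = word_value_append[OF K]
  have "word_value K a b [Inv, Inv] = \<one>\<^bsub>K\<^esub>" "word_value K a b [Rot, Rot, Rot] = \<one>\<^bsub>K\<^esub>"
    using rel K(2,3) by (simp_all add: K.m_assoc)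
  then have *: "word_value K a b (p @ [Inv, Inv] @ q) = word_value K a b (p @ q)"
    "word_value K a b (p @ [Rot, Rot, Rot] @ q) = word_value K a b (p @ q)" for p q
    by (simp_all only: app K.l_one)
  show ?thesis
    using assms(6) by induction (simp_all only: *)
qed

text \<open>
  The group is the internal free product of a group of order 2 and a group of order 3. The last
  assumption expresses the absence of further relations.
\<close>

locale order_2_3_product = group G for G (structure) +
  fixes S U :: 'a
  assumes S_closed [simp]: "S \<in> carrier G"
    and U_closed [simp]: "U \<in> carrier G"
    and S_squared: "S \<otimes> S = \<one>"
    and U_cubed: "U \<otimes> U \<otimes> U = \<one>"
    and words_generate: "g \<in> carrier G \<Longrightarrow> \<exists>w. word_value G S U w = g"
    and no_other_relations: "word_value G S U w = \<one> \<Longrightarrow> cancels w []"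
begin

abbreviation ev :: "letter list \<Rightarrow> 'a" where "ev \<equiv> word_value G S U"

lemmas ev_closed [simp] = word_value_append(1)[OF is_group S_closed U_closed]
lemmas ev_append = word_value_append(2)[OF is_group S_closed U_closed]

end

section \<open>Cosets and cocycles\<close>

locale order_2_3_subgroup = order_2_3_product G S U for G (structure) and S U +
  fixes H :: "'a set"
  assumes H: "subgroup H G"
begin

abbreviation cosets :: "'a set set" where "cosets \<equiv> rcosets H"
abbreviation s :: "'a set \<Rightarrow> 'a set" where "s x \<equiv> x #> S"
abbreviation u :: "'a set \<Rightarrow> 'a set" where "u x \<equiv> x #> U"

lemma H_subset: "H \<subseteq> carrier G"
  using H by (rule subgroup.subset)

lemma base_coset [simp]: "H \<in> cosets"
  using rcosetsI[OF H_subset one_closed] by (simp add: H_subset)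

lemma coset_subset: "x \<in> cosets \<Longrightarrow> x \<subseteq> carrier G"
  using subgroup.rcosets_carrier[OF H is_group] .

lemma coset_mult_closed [simp]: "x \<in> cosets \<Longrightarrow> g \<in> carrier G \<Longrightarrow> x #> g \<in> cosets"
  unfolding RCOSETS_def using H_subset by (auto simp: coset_mult_assoc)

lemma coset_assoc: "x \<in> cosets \<Longrightarrow> g \<in> carrier G \<Longrightarrow> h \<in> carrier G \<Longrightarrow> x #> g #> h = x #> g \<otimes> h"
  by (simp add: coset_mult_assoc coset_subset)

lemma coset_one: "x \<in> cosets \<Longrightarrow> x #> \<one> = x"
  by (simp add: coset_mult_one coset_subset)

lemma s_s [simp]: "x \<in> cosets \<Longrightarrow> s (s x) = x"
  by (simp add: coset_assoc S_squared coset_one)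

lemma u_u_u [simp]: "x \<in> cosets \<Longrightarrow> u (u (u x)) = x"
  by (simp add: coset_assoc m_assoc[symmetric] U_cubed coset_one)

text \<open>The cosets form a single orbit, and \<open>S\<close> and \<open>U\<close> generate the group.\<close>

lemma coset_induct [consumes 1, case_names base s u]:
  assumes "x \<in> cosets" and "P H"
    and "\<And>x. x \<in> cosets \<Longrightarrow> P x \<Longrightarrow> P (s x)" and "\<And>x. x \<in> cosets \<Longrightarrow> P x \<Longrightarrow> P (u x)"
  shows "P x"
proof -
  have *: "P (y #> ev w)" if "y \<in> cosets" "P y" for y w
    using that
  proof (induction w arbitrary: y)
    case (Cons l w)
    have "y #> case_letter S U l \<in> cosets \<and> P (y #> case_letter S U l)"
      using Cons.prems assms(3,4) by (cases l) auto
    then have "P (y #> case_letter S U l #> ev w)"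
      using Cons.IH by blast
    then show ?case
      using Cons.prems by (cases l) (simp_all add: coset_assoc)
  qed (simp add: coset_one)
  obtain g where "g \<in> carrier G" "x = H #> g"
    using assms(1) by (auto simp: RCOSETS_def)
  then show ?thesis
    using *[OF base_coset assms(2)] words_generate by metis
qed

text \<open>
  The only value that a cocycle extending \<open>cS\<close> and \<open>cU\<close> can take at the value of a word.
\<close>

primrec word_cocycle ::
  "('c, 'd) monoid_scheme \<Rightarrow> ('a set \<Rightarrow> 'c) \<Rightarrow> ('a set \<Rightarrow> 'c) \<Rightarrow> letter list \<Rightarrow> 'a set \<Rightarrow> 'c"
where
  "word_cocycle F cS cU [] x = \<one>\<^bsub>F\<^esub>"
| "word_cocycle F cS cU (l # w) x = (case l of
      Inv \<Rightarrow> cS x \<otimes>\<^bsub>F\<^esub> word_cocycle F cS cU w (s x)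
    | Rot \<Rightarrow> cU x \<otimes>\<^bsub>F\<^esub> word_cocycle F cS cU w (u x))"

text \<open>
  A cocycle with values in \<open>F\<close> is the same as an action of the group on the product of the set of
  cosets and \<open>F\<close> that lifts the action on cosets and commutes with left multiplication by
  \<open>F\<close>: \<open>g\<close> takes \<open>(x, f)\<close> to \<open>(x g, f C(x, g))\<close>. The free product acts as soon
  as \<open>S\<close> and \<open>U\<close> act with the right orders, and this is what the two relations say. The
  argument runs on words: the product of the prescribed values along a word is invariant under
  cancellation, and two words with the same value differ by words that cancel completely.
\<close>

lemma cocycle_extension:
  assumes F: "group F"
    and cS: "\<And>x. x \<in> cosets \<Longrightarrow> cS x \<in> carrier F"
    and cU: "\<And>x. x \<in> cosets \<Longrightarrow> cU x \<in> carrier F"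
    and rel_S: "\<And>x. x \<in> cosets \<Longrightarrow> cS x \<otimes>\<^bsub>F\<^esub> cS (s x) = \<one>\<^bsub>F\<^esub>"
    and rel_U: "\<And>x. x \<in> cosets \<Longrightarrow> cU x \<otimes>\<^bsub>F\<^esub> cU (u x) \<otimes>\<^bsub>F\<^esub> cU (u (u x)) = \<one>\<^bsub>F\<^esub>"
  shows "\<exists>C. (\<forall>x\<in>cosets. \<forall>g\<in>carrier G. C x g \<in> carrier F) \<and>
    (\<forall>x\<in>cosets. \<forall>g\<in>carrier G. \<forall>h\<in>carrier G.
      C x (g \<otimes> h) = C x g \<otimes>\<^bsub>F\<^esub> C (x #> g) h) \<and>
    (\<forall>x\<in>cosets. C x S = cS x \<and> C x U = cU x)"
proof -
  interpret F: group F by (rule F)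
  let ?c = "word_cocycle F cS cU"
  have closed: "?c w x \<in> carrier F" if "x \<in> cosets" for w x
    using that by (induction w arbitrary: x) (auto simp: cS cU split: letter.split)
  have append: "?c (v @ w) x = ?c v x \<otimes>\<^bsub>F\<^esub> ?c w (x #> ev v)" if "x \<in> cosets" for v w x
    using that by (induction v arbitrary: x)
      (auto simp: cS cU closed F.m_assoc coset_one coset_assoc split: letter.split)
  have cancel: "?c v x = ?c w x" if "cancels v w" "x \<in> cosets" for v w x
    using that
  proof (induction rule: cancels.induct)
    case (inv w p q)
    let ?y = "x #> ev p"
    have y: "?y \<in> cosets"
      using inv by simp
    have "?c [Inv, Inv] ?y = \<one>\<^bsub>F\<^esub>"
      using y by (simp add: rel_S cS)
    moreover have "?y #> ev [Inv, Inv] = ?y"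
      using y by (simp add: S_squared coset_one)
    ultimately have "?c ([Inv, Inv] @ q) ?y = ?c q ?y"
      by (subst append[OF y]) (simp add: closed y)
    then show ?case
      using inv by (simp add: append del: append_Cons append_Nil word_cocycle.simps)
  next
    case (rot w p q)
    let ?y = "x #> ev p"
    have y: "?y \<in> cosets"
      using rot by simp
    have "?c [Rot, Rot, Rot] ?y = \<one>\<^bsub>F\<^esub>"
      using y rel_U[OF y] by (simp add: cU F.m_assoc)
    moreover have "?y #> ev [Rot, Rot, Rot] = ?y"
      using y by (simp add: U_cubed m_assoc[symmetric] coset_one)
    ultimately have "?c ([Rot, Rot, Rot] @ q) ?y = ?c q ?y"
      by (subst append[OF y]) (simp add: closed y)
    then show ?case
      using rot by (simp add: append del: append_Cons append_Nil word_cocycle.simps)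
  qed simp
  \<comment> \<open>A word \<open>w'\<close> for the inverse makes both \<open>v @ w'\<close> and \<open>w' @ w\<close> cancel, so that
    \<open>v @ w' @ w\<close> has the same product as \<open>v\<close> and as \<open>w\<close>.\<close>
  have well_defined: "?c v x = ?c w x" if "ev v = ev w" "x \<in> cosets" for v w x
  proof -
    obtain w' where w': "ev w' = inv (ev w)"
      using words_generate[of "inv (ev w)"] by auto
    have one: "ev (v @ w') = \<one>" "ev (w' @ w) = \<one>"
      using that w' by (simp_all add: ev_append)
    have "?c v x = ?c v x \<otimes>\<^bsub>F\<^esub> ?c (w' @ w) (x #> ev v)"
      using cancel[OF no_other_relations[OF one(2)]] that by (simp add: closed)
    also have "\<dots> = ?c ((v @ w') @ w) x"
      using that by (simp add: append)
    also have "\<dots> = ?c (v @ w') x \<otimes>\<^bsub>F\<^esub> ?c w x"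
      using that one by (subst append) (simp_all add: coset_one)
    also have "\<dots> = ?c w x"
      using cancel[OF no_other_relations[OF one(1)]] that by (simp add: closed)
    finally show ?thesis .
  qed
  define C where "C x g = ?c (SOME w. ev w = g) x" for x g
  have C: "C x (ev w) = ?c w x" if "x \<in> cosets" for x w
    unfolding C_def by (rule well_defined[OF someI that]) (rule HOL.refl)
  show ?thesis
  proof (intro exI[of _ C] conjI ballI)
    show "C x g \<in> carrier F" if "x \<in> cosets" "g \<in> carrier G" for x g
      using that words_generate[of g] C closed by metis
    show "C x (g \<otimes> h) = C x g \<otimes>\<^bsub>F\<^esub> C (x #> g) h"
      if x: "x \<in> cosets" and gh: "g \<in> carrier G" "h \<in> carrier G" for x g h
    proof -
      obtain v w where "g = ev v" "h = ev w"
        using gh words_generate by metis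
      then show ?thesis
        using x C append by (simp add: ev_append[symmetric])
    qed
    show "C x S = cS x" if "x \<in> cosets" for x
      using C[of x "[Inv]"] that by (simp add: cS)
    show "C x U = cU x" if "x \<in> cosets" for x
      using C[of x "[Rot]"] that by (simp add: cU)
  qed
qed

section \<open>Spanning trees of the coset graph\<close>

text \<open>
  A triple \<open>tree T A B\<close> is a subtree of the graph, grown edge by edge from the orbit of the coset
  \<open>H\<close> under \<open>S\<close>. Its vertices are the orbits of \<open>S\<close> contained in \<open>A\<close> and the orbits of \<open>U\<close>
  contained in \<open>B\<close>; its edges are the cosets in \<open>T\<close>. Keeping the unions of the orbits instead
  of the sets of orbits avoids quotients, and rule induction over the growth serves at once for
  counting, for choosing representatives and for propagating identities.
\<close>

inductive tree :: "'a set set \<Rightarrow> 'a set set \<Rightarrow> 'a set set \<Rightarrow> bool" where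
  base: "tree {} {H, s H} {}"
| add_rot: "tree T A B \<Longrightarrow> x \<in> A \<Longrightarrow> x \<notin> B \<Longrightarrow> tree (insert x T) A (B \<union> {x, u x, u (u x)})"
| add_inv: "tree T A B \<Longrightarrow> x \<in> B \<Longrightarrow> x \<notin> A \<Longrightarrow> tree (insert x T) (A \<union> {x, s x}) B"

lemma tree_closed:
  assumes "tree T A B"
  shows "A \<subseteq> cosets" "B \<subseteq> cosets" "T \<subseteq> A" "T \<subseteq> B" "H \<in> A"
    and "\<And>x. x \<in> A \<Longrightarrow> s x \<in> A" and "\<And>x. x \<in> B \<Longrightarrow> u x \<in> B"
proof -
  have "A \<subseteq> cosets \<and> B \<subseteq> cosets \<and> T \<subseteq> A \<and> T \<subseteq> B \<and> H \<in> A \<and>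
    (\<forall>x\<in>A. s x \<in> A) \<and> (\<forall>x\<in>B. u x \<in> B)"
    using assms
  proof induction
    case base
    show ?case
      by simp
  next
    case (add_rot T A B x)
    then have "x \<in> cosets"
      by blast
    then show ?case
      using add_rot by (simp add: subset_insertI2)
  next
    case (add_inv T A B x)
    then have "x \<in> cosets"
      by blast
    then show ?case
      using add_inv by (simp add: subset_insertI2)
  qed
  then show "A \<subseteq> cosets" "B \<subseteq> cosets" "T \<subseteq> A" "T \<subseteq> B" "H \<in> A"
    and "\<And>x. x \<in> A \<Longrightarrow> s x \<in> A" and "\<And>x. x \<in> B \<Longrightarrow> u x \<in> B"
    by blast+
qed

text \<open>
  In a largest subtree \<open>A = B\<close>, since a coset in only one of them could be added as an edge. So
  \<open>A\<close> is closed under \<open>S\<close> and \<open>U\<close> and contains \<open>H\<close>, hence every coset.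
\<close>

lemma spanning_tree_exists:
  assumes fin: "finite cosets"
  obtains T where "tree T cosets cosets"
proof -
  define P where "P = (\<lambda>(T, A, B). tree T A B)"
  define size where "size = (\<lambda>(T :: 'a set set, A :: 'a set set, B :: 'a set set). card A + card B)"
  have bound: "size X \<le> 2 * card cosets" if "P X" for X
  proof -
    obtain T A B where X: "X = (T, A, B)"
      by (cases X)
    then have "tree T A B"
      using that by (simp add: P_def)
    then have "A \<subseteq> cosets" "B \<subseteq> cosets"
      using tree_closed by blast+
    then have "card A \<le> card cosets" "card B \<le> card cosets"
      using fin card_mono by blast+
    then show ?thesis
      by (simp add: X size_def)
  qed
  have "P ({}, {H, s H}, {})"
    by (simp add: P_def tree.base)
  then obtain X where X: "P X" "\<And>Y. P Y \<Longrightarrow> size Y \<le> size X"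
    using ex_has_greatest_nat[of P _ size "2 * card cosets + 1"] bound by (metis Suc_eq_plus1 le_imp_less_Suc less_imp_le)
  obtain T A B where eq: "X = (T, A, B)"
    by (cases X)
  have tree: "tree T A B"
    using X(1) by (simp add: P_def eq)
  note closed = tree_closed[OF tree]
  have finA: "finite A" and finB: "finite B"
    using closed(1,2) fin by (meson finite_subset)+
  have "A \<subseteq> B"
  proof
    fix x assume x: "x \<in> A"
    show "x \<in> B"
    proof (rule ccontr)
      assume "x \<notin> B"
      then have "card A + card (B \<union> {x, u x, u (u x)}) \<le> card A + card B"
        using X(2)[of "(insert x T, A, B \<union> {x, u x, u (u x)})"] tree.add_rot[OF tree x]
        by (simp add: P_def size_def eq)
      moreover have "card B < card (B \<union> {x, u x, u (u x)})"
        using \<open>x \<notin> B\<close> finB by (intro psubset_card_mono) auto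
      ultimately show False
        by simp
    qed
  qed
  moreover have "B \<subseteq> A"
  proof
    fix x assume x: "x \<in> B"
    show "x \<in> A"
    proof (rule ccontr)
      assume "x \<notin> A"
      then have "card (A \<union> {x, s x}) + card B \<le> card A + card B"
        using X(2)[of "(insert x T, A \<union> {x, s x}, B)"] tree.add_inv[OF tree x]
        by (simp add: P_def size_def eq)
      moreover have "card A < card (A \<union> {x, s x})"
        using \<open>x \<notin> A\<close> finA by (intro psubset_card_mono) auto
      ultimately show False
        by simp
    qed
  qed
  ultimately have AB: "A = B"
    by blast
  have "x \<in> A" if "x \<in> cosets" for x
    using that by (induction rule: coset_induct) (use closed AB in auto)
  then have "A = cosets"
    using closed by blast
  then show thesis
    using that tree AB by blast
qed

text \<open>
  This is "vertices = edges + 1", multiplied by 6. An orbit of \<open>S\<close> has two elements or is one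
  fixed point, so that \<open>A\<close> contains \<open>(card A + fixed points) / 2\<close> orbits; an orbit of \<open>U\<close>
  has three elements or is one fixed point, so that \<open>B\<close> contains
  \<open>(card B + 2 * fixed points) / 3\<close> orbits.
\<close>

lemma spanning_tree_count:
  assumes "finite cosets" and "tree T A B"
  shows "6 * (card T + 1) =
    3 * (card A + card {x \<in> A. s x = x}) + 2 * (card B + 2 * card {x \<in> B. u x = x})"
  using assms(2)
proof induction
  case base
  show ?case
  proof (cases "s H = H")
    case True
    then have "{x \<in> {H, s H}. s x = x} = {H}"
      by auto
    then show ?thesis
      using True by (simp only: insert_absorb2) simp
  next
    case False
    then have "s (s H) \<noteq> s H"
      using s_s[OF base_coset] by metis
    then have "{x \<in> {H, s H}. s x = x} = {}"
      using False by blast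
    then show ?thesis
      using False by (simp only: card_insert_if) simp
  qed
next
  case (add_rot T A B x)
  note closed = tree_closed[OF add_rot.hyps(1)]
  have x: "x \<in> cosets"
    using add_rot.hyps closed(1) by blast
  have fin: "finite T" "finite B"
    using closed(2,4) assms(1) by (meson finite_subset)+
  have "x \<notin> T"
    using add_rot.hyps closed(4) by blast
  then have T: "card (insert x T) = card T + 1"
    using fin by simp
  have "u y \<in> B" if "y \<in> B" for y
    using closed(7) that .
  from this[of "u x"] this[of "u (u x)"] have notin: "u x \<notin> B" "u (u x) \<notin> B"
    using \<open>x \<notin> B\<close> x by auto
  show ?case
  proof (cases "u x = x")
    case True
    have "{y \<in> B \<union> {x, u x, u (u x)}. u y = y} = insert x {y \<in> B. u y = y}"
      using True by auto
    then show ?thesis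
      using True T add_rot.IH add_rot.hyps(2,3) fin by simp
  next
    case False
    have ne: "u (u x) \<noteq> u x" "u (u x) \<noteq> x"
      using False u_u_u[OF x] by (force, metis)
    have "u (u (u x)) \<noteq> u (u x)"
      using ne(2) u_u_u[OF x] by metis
    then have "{y \<in> B \<union> {x, u x, u (u x)}. u y = y} = {y \<in> B. u y = y}"
      using False ne(1) by blast
    moreover have "card (B \<union> {x, u x, u (u x)}) = card B + 3"
      using False ne notin \<open>x \<notin> B\<close> fin by simp
    ultimately show ?thesis
      using T add_rot.IH by simp
  qed
next
  case (add_inv T A B x)
  note closed = tree_closed[OF add_inv.hyps(1)]
  have x: "x \<in> cosets"
    using add_inv.hyps closed(2) by blast
  have fin: "finite T" "finite A"
    using closed(1,3) assms(1) by (meson finite_subset)+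
  have "x \<notin> T"
    using add_inv.hyps closed(3) by blast
  then have T: "card (insert x T) = card T + 1"
    using fin by simp
  have "s y \<in> A" if "y \<in> A" for y
    using closed(6) that .
  from this[of "s x"] have notin: "s x \<notin> A"
    using \<open>x \<notin> A\<close> x by auto
  show ?case
  proof (cases "s x = x")
    case True
    have "{y \<in> A \<union> {x, s x}. s y = y} = insert x {y \<in> A. s y = y}"
      using True by auto
    then show ?thesis
      using True T add_inv.IH add_inv.hyps(2,3) fin by simp
  next
    case False
    have "s (s x) \<noteq> s x"
      using False s_s[OF x] by metis
    then have "{y \<in> A \<union> {x, s x}. s y = y} = {y \<in> A. s y = y}"
      using False by blast
    moreover have "card (A \<union> {x, s x}) = card A + 2"
      using False notin \<open>x \<notin> A\<close> fin by simp
    ultimately show ?thesis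
      using T add_inv.IH by simp
  qed
qed

text \<open>
  Coset representatives on \<open>A\<close> that move along with the generator \<open>g\<close>. Fixed points of
  \<open>g\<close> have to be excepted: there \<open>\<alpha> x\<close> and \<open>\<alpha> x \<otimes> g\<close> represent the same
  coset, and their quotient, a conjugate of \<open>g\<close>, is an element of \<open>H\<close>.
\<close>

definition is_section :: "'a set set \<Rightarrow> 'a \<Rightarrow> ('a set \<Rightarrow> 'a) \<Rightarrow> bool" where
  "is_section A g \<alpha> \<longleftrightarrow> (\<forall>x\<in>A. \<alpha> x \<in> carrier G \<and> H #> \<alpha> x = x \<and>
    (x #> g \<noteq> x \<longrightarrow> \<alpha> (x #> g) = \<alpha> x \<otimes> g))"

lemma is_sectionD:
  assumes "is_section A g \<alpha>" "x \<in> A"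
  shows "\<alpha> x \<in> carrier G" "H #> \<alpha> x = x" "x #> g \<noteq> x \<Longrightarrow> \<alpha> (x #> g) = \<alpha> x \<otimes> g"
  using assms by (auto simp: is_section_def)

text \<open>
  The representatives at the vertex of an orbit are determined by one of them. A new vertex of the
  tree inherits its representatives through the edge by which it is attached, which is why the two
  sections agree on the edges of the tree.
\<close>

lemma tree_sections:
  assumes "tree T A B"
  shows "\<exists>\<alpha> \<beta>. is_section A S \<alpha> \<and> is_section B U \<beta> \<and> \<alpha> H = \<one> \<and> (\<forall>x\<in>T. \<alpha> x = \<beta> x)"
  using assms
proof induction
  case base
  have "is_section {H, s H} S (\<lambda>x. if x = H then \<one> else S)"
    using H_subset s_s[OF base_coset] by (auto simp: is_section_def S_squared)
  then show ?case
    by (intro exI[of _ "\<lambda>x. if x = H then \<one> else S"]) (simp add: is_section_def)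
next
  case (add_rot T A B x)
  note closed = tree_closed[OF add_rot.hyps(1)]
  have x: "x \<in> cosets"
    using add_rot.hyps closed(1) by blast
  obtain \<alpha> \<beta> where ab: "is_section A S \<alpha>" "is_section B U \<beta>" "\<alpha> H = \<one>" "\<forall>x\<in>T. \<alpha> x = \<beta> x"
    using add_rot.IH by blast
  note a = is_sectionD[OF ab(1) \<open>x \<in> A\<close>]
  define \<beta>' where "\<beta>' y = (if y \<in> B then \<beta> y else if y = x then \<alpha> x
    else if y = u x then \<alpha> x \<otimes> U else \<alpha> x \<otimes> U \<otimes> U)" for y
  have "u y \<in> B" if "y \<in> B" for y
    using closed(7) that .
  from this[of "u x"] this[of "u (u x)"] have notin: "u x \<notin> B" "u (u x) \<notin> B"
    using \<open>x \<notin> B\<close> x by auto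
  have "\<forall>y\<in>B. \<beta>' y \<in> carrier G \<and> H #> \<beta>' y = y \<and> (u y \<noteq> y \<longrightarrow> \<beta>' (u y) = \<beta>' y \<otimes> U)"
    using ab(2) closed(7) by (simp add: is_section_def \<beta>'_def)
  moreover have "\<forall>y\<in>{x, u x, u (u x)}.
    \<beta>' y \<in> carrier G \<and> H #> \<beta>' y = y \<and> (u y \<noteq> y \<longrightarrow> \<beta>' (u y) = \<beta>' y \<otimes> U)"
  proof (cases "u x = x")
    case True
    then show ?thesis
      using a \<open>x \<notin> B\<close> by (simp add: \<beta>'_def)
  next
    case False
    have ne: "u (u x) \<noteq> u x" "u (u x) \<noteq> x"
      using False u_u_u[OF x] by (force, metis)
    have b: "\<beta>' x = \<alpha> x" "\<beta>' (u x) = \<alpha> x \<otimes> U" "\<beta>' (u (u x)) = \<alpha> x \<otimes> U \<otimes> U"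
      using notin \<open>x \<notin> B\<close> False ne by (auto simp: \<beta>'_def)
    have "H #> (\<alpha> x \<otimes> U) = u x" "H #> (\<alpha> x \<otimes> U \<otimes> U) = u (u x)"
      using a by (metis base_coset coset_assoc m_closed U_closed)+
    moreover have "\<alpha> x \<otimes> U \<otimes> U \<otimes> U = \<alpha> x"
      using a U_cubed by (simp add: m_assoc)
    ultimately show ?thesis
      using a b x by simp
  qed
  ultimately have "is_section (B \<union> {x, u x, u (u x)}) U \<beta>'"
    unfolding is_section_def by blast
  moreover have "\<forall>y\<in>insert x T. \<alpha> y = \<beta>' y"
    using ab(4) closed(4) \<open>x \<notin> B\<close> by (auto simp: \<beta>'_def)
  ultimately show ?case
    using ab by blast
next
  case (add_inv T A B x)
  note closed = tree_closed[OF add_inv.hyps(1)]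
  have x: "x \<in> cosets"
    using add_inv.hyps closed(2) by blast
  obtain \<alpha> \<beta> where ab: "is_section A S \<alpha>" "is_section B U \<beta>" "\<alpha> H = \<one>" "\<forall>x\<in>T. \<alpha> x = \<beta> x"
    using add_inv.IH by blast
  note b = is_sectionD[OF ab(2) \<open>x \<in> B\<close>]
  define \<alpha>' where "\<alpha>' y = (if y \<in> A then \<alpha> y else if y = x then \<beta> x else \<beta> x \<otimes> S)" for y
  have "s y \<in> A" if "y \<in> A" for y
    using closed(6) that .
  from this[of "s x"] have notin: "s x \<notin> A"
    using \<open>x \<notin> A\<close> x by auto
  have "\<forall>y\<in>A. \<alpha>' y \<in> carrier G \<and> H #> \<alpha>' y = y \<and> (s y \<noteq> y \<longrightarrow> \<alpha>' (s y) = \<alpha>' y \<otimes> S)"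
    using ab(1) closed(6) by (simp add: is_section_def \<alpha>'_def)
  moreover have "\<forall>y\<in>{x, s x}.
    \<alpha>' y \<in> carrier G \<and> H #> \<alpha>' y = y \<and> (s y \<noteq> y \<longrightarrow> \<alpha>' (s y) = \<alpha>' y \<otimes> S)"
  proof (cases "s x = x")
    case True
    then show ?thesis
      using b \<open>x \<notin> A\<close> by (simp add: \<alpha>'_def)
  next
    case False
    have a: "\<alpha>' x = \<beta> x" "\<alpha>' (s x) = \<beta> x \<otimes> S"
      using notin \<open>x \<notin> A\<close> False by (auto simp: \<alpha>'_def)
    have "H #> (\<beta> x \<otimes> S) = s x"
      using b by (metis base_coset coset_assoc S_closed)
    moreover have "\<beta> x \<otimes> S \<otimes> S = \<beta> x"
      using b S_squared by (simp add: m_assoc)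
    ultimately show ?thesis
      using a b x by simp
  qed
  ultimately have "is_section (A \<union> {x, s x}) S \<alpha>'"
    unfolding is_section_def by blast
  moreover have "\<forall>y\<in>insert x T. \<alpha>' y = \<beta> y"
    using ab(4) closed(3) \<open>x \<notin> A\<close> by (auto simp: \<alpha>'_def)
  moreover have "\<alpha>' H = \<one>"
    using ab closed(5) by (simp add: \<alpha>'_def)
  ultimately show ?case
    using ab by blast
qed

text \<open>
  A property that is constant on the orbits of \<open>S\<close>, one that is constant on the orbits of
  \<open>U\<close>, and agreement of the two on the edges: from the root they reach every vertex.
\<close>

lemma tree_propagate:
  assumes "tree T A B" and "P H"
    and "\<And>x. x \<in> cosets \<Longrightarrow> P x \<Longrightarrow> P (s x)" and "\<And>x. x \<in> cosets \<Longrightarrow> Q x \<Longrightarrow> Q (u x)"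
    and "\<And>x. x \<in> T \<Longrightarrow> P x \<longleftrightarrow> Q x"
  shows "(\<forall>x\<in>A. P x) \<and> (\<forall>x\<in>B. Q x)"
  using assms(1,5)
proof induction
  case base
  then show ?case
    using assms(2,3) by simp
next
  case (add_rot T A B x)
  have x: "x \<in> cosets"
    using add_rot.hyps tree_closed(1) by blast
  have IH: "(\<forall>x\<in>A. P x) \<and> (\<forall>x\<in>B. Q x)"
    using add_rot.IH add_rot.prems by simp
  then have "Q x"
    using add_rot.prems[of x] add_rot.hyps(2) by simp
  then have "Q (u x)" "Q (u (u x))"
    using x assms(4) by simp_all
  then show ?case
    using IH \<open>Q x\<close> by simp
next
  case (add_inv T A B x)
  have x: "x \<in> cosets"
    using add_inv.hyps tree_closed(2) by blast
  have IH: "(\<forall>x\<in>A. P x) \<and> (\<forall>x\<in>B. Q x)"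
    using add_inv.IH add_inv.prems by simp
  then have "P x"
    using add_inv.prems[of x] add_inv.hyps(2) by simp
  then have "P (s x)"
    using x assms(3) by simp
  then show ?case
    using IH \<open>P x\<close> by simp
qed

lemma right_quotient_in_subgroup:
  assumes "g \<in> carrier G" "h \<in> carrier G" "H #> g = H #> h"
  shows "g \<otimes> inv h \<in> H"
  using assms H by (metis rcos_self subgroup.rcos_module_imp is_group)

section \<open>The subgroup presented by a spanning tree\<close>

text \<open>
  The assumptions \<open>extend\<close> and \<open>unique\<close> say that \<open>F\<close> is freely generated by elements
  \<open>e x\<close> for the edges outside the tree, involutions \<open>y x\<close> for the cosets fixed by \<open>S\<close>,
  and elements \<open>z x\<close> of order 3 for the cosets fixed by \<open>U\<close>; they are stated only for the two
  target groups that occur, \<open>H\<close> and \<open>F\<close>. Two sections \<open>\<alpha>\<close> and \<open>\<beta>\<close> give the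
  elements \<open>\<alpha> x (\<beta> x)\<^sup>-\<^sup>1\<close>, \<open>\<alpha> x S (\<alpha> x)\<^sup>-\<^sup>1\<close> and
  \<open>\<beta> x U (\<beta> x)\<^sup>-\<^sup>1\<close> of \<open>H\<close>, and so a homomorphism \<open>\<phi>\<close> from \<open>F\<close>. In the
  other direction, the cocycle \<open>C\<close> is the one for which
  \<open>\<phi> (C x g) = \<alpha> x g (\<alpha> (x g))\<^sup>-\<^sup>1\<close>; at \<open>x = H\<close> and for \<open>g\<close> in \<open>H\<close> the
  right-hand side is \<open>g\<close>. That \<open>C\<close> takes the three kinds of elements of \<open>H\<close> back to the
  generators of \<open>F\<close> follows from \<open>C H (\<alpha> x) = 1\<close> and \<open>C H (\<beta> x) = (e x)\<^sup>-\<^sup>1\<close>,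
  which hold along the tree.
\<close>

lemma subgroup_iso_of_tree:
  fixes F :: "('c, 'd) monoid_scheme" and e y z :: "'a set \<Rightarrow> 'c"
  assumes tree: "tree T cosets cosets" and F: "group F"
    and closed: "\<And>x. e x \<in> carrier F" "\<And>x. y x \<in> carrier F" "\<And>x. z x \<in> carrier F"
    and e_tree: "\<And>x. x \<in> T \<Longrightarrow> e x = \<one>\<^bsub>F\<^esub>"
    and y_order: "\<And>x. y x \<otimes>\<^bsub>F\<^esub> y x = \<one>\<^bsub>F\<^esub>"
    and z_order: "\<And>x. z x \<otimes>\<^bsub>F\<^esub> z x \<otimes>\<^bsub>F\<^esub> z x = \<one>\<^bsub>F\<^esub>"
    and extend: "\<And>e' y' z' :: 'a set \<Rightarrow> 'a.
      \<lbrakk>\<And>x. x \<in> cosets - T \<Longrightarrow> e' x \<in> H;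
       \<And>x. \<lbrakk>x \<in> cosets; s x = x\<rbrakk> \<Longrightarrow> y' x \<in> H \<and> y' x \<otimes> y' x = \<one>;
       \<And>x. \<lbrakk>x \<in> cosets; u x = x\<rbrakk> \<Longrightarrow> z' x \<in> H \<and> z' x \<otimes> z' x \<otimes> z' x = \<one>\<rbrakk> \<Longrightarrow>
      \<exists>\<phi>\<in>hom F (G\<lparr>carrier := H\<rparr>). (\<forall>x\<in>cosets - T. \<phi> (e x) = e' x) \<and>
        (\<forall>x\<in>cosets. s x = x \<longrightarrow> \<phi> (y x) = y' x) \<and> (\<forall>x\<in>cosets. u x = x \<longrightarrow> \<phi> (z x) = z' x)"
    and unique: "\<And>\<theta> f. \<lbrakk>\<theta> \<in> hom F F; \<And>x. x \<in> cosets - T \<Longrightarrow> \<theta> (e x) = e x;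
       \<And>x. x \<in> cosets \<Longrightarrow> s x = x \<Longrightarrow> \<theta> (y x) = y x;
       \<And>x. x \<in> cosets \<Longrightarrow> u x = x \<Longrightarrow> \<theta> (z x) = z x; f \<in> carrier F\<rbrakk> \<Longrightarrow> \<theta> f = f"
  shows "G\<lparr>carrier := H\<rparr> \<cong> F"
proof -
  interpret F: group F by (rule F)
  have K: "group (G\<lparr>carrier := H\<rparr>)"
    using H by (rule subgroup.subgroup_is_group) (rule is_group)
  have HG: "h \<in> carrier G" if "h \<in> H" for h
    using that H_subset by blast
  obtain \<alpha> \<beta> where ab: "is_section cosets S \<alpha>" "is_section cosets U \<beta>" "\<alpha> H = \<one>"
      "\<forall>x\<in>T. \<alpha> x = \<beta> x"
    using tree_sections[OF tree] by blast
  note a = is_sectionD[OF ab(1)] and b = is_sectionD[OF ab(2)]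

  \<comment> \<open>The values are chosen such that \<open>\<phi>\<close> will send them to
    \<open>\<alpha> x S (\<alpha> (s x))\<^sup>-\<^sup>1\<close> and \<open>\<alpha> x U (\<alpha> (u x))\<^sup>-\<^sup>1\<close>.\<close>
  define cS where "cS x = (if s x = x then y x else \<one>\<^bsub>F\<^esub>)" for x
  define v where "v x = (if u x = x then z x else \<one>\<^bsub>F\<^esub>)" for x
  define cU where "cU x = e x \<otimes>\<^bsub>F\<^esub> v x \<otimes>\<^bsub>F\<^esub> inv\<^bsub>F\<^esub> e (u x)" for x
  have v_closed: "v x \<in> carrier F" for x
    by (simp add: v_def closed)
  have cS_closed: "cS x \<in> carrier F" and cU_closed: "cU x \<in> carrier F" for x
    by (simp_all add: cS_def cU_def v_closed closed)
  have cancel: "inv\<^bsub>F\<^esub> f \<otimes>\<^bsub>F\<^esub> (f \<otimes>\<^bsub>F\<^esub> g) = g" "f \<otimes>\<^bsub>F\<^esub> (inv\<^bsub>F\<^esub> f \<otimes>\<^bsub>F\<^esub> g) = g"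
    if "f \<in> carrier F" "g \<in> carrier F" for f g
    using that by (simp_all add: F.m_assoc[symmetric])
  have rel_S: "cS x \<otimes>\<^bsub>F\<^esub> cS (s x) = \<one>\<^bsub>F\<^esub>" if "x \<in> cosets" for x
  proof (cases "s x = x")
    case True
    then show ?thesis
      by (simp add: cS_def y_order)
  next
    case False
    then have "s (s x) \<noteq> s x"
      using s_s[OF that] by metis
    then show ?thesis
      using False by (simp add: cS_def)
  qed
  have v3: "v x \<otimes>\<^bsub>F\<^esub> (v (u x) \<otimes>\<^bsub>F\<^esub> v (u (u x))) = \<one>\<^bsub>F\<^esub>" if "x \<in> cosets" for x
  proof (cases "u x = x")
    case True
    then show ?thesis
      using z_order[of x] by (simp add: v_def F.m_assoc closed)
  next
    case False
    then have "u (u x) \<noteq> u x" "u (u (u x)) \<noteq> u (u x)"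
      using u_u_u[OF that] by metis+
    then have "v x = \<one>\<^bsub>F\<^esub>" "v (u x) = \<one>\<^bsub>F\<^esub>" "v (u (u x)) = \<one>\<^bsub>F\<^esub>"
      using False by (simp_all only: v_def if_False)
    then show ?thesis
      by simp
  qed
  have rel_U: "cU x \<otimes>\<^bsub>F\<^esub> cU (u x) \<otimes>\<^bsub>F\<^esub> cU (u (u x)) = \<one>\<^bsub>F\<^esub>" if "x \<in> cosets" for x
  proof -
    have "cU x \<otimes>\<^bsub>F\<^esub> cU (u x) \<otimes>\<^bsub>F\<^esub> cU (u (u x)) =
        e x \<otimes>\<^bsub>F\<^esub> (v x \<otimes>\<^bsub>F\<^esub> (v (u x) \<otimes>\<^bsub>F\<^esub> v (u (u x)))) \<otimes>\<^bsub>F\<^esub> inv\<^bsub>F\<^esub> e x"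
      using that by (simp add: cU_def closed v_closed F.m_assoc cancel)
    then show ?thesis
      using that by (simp add: v3 closed)
  qed
  obtain C where C_all: "\<forall>x\<in>cosets. \<forall>g\<in>carrier G. C x g \<in> carrier F"
      "\<forall>x\<in>cosets. \<forall>g\<in>carrier G. \<forall>h\<in>carrier G.
        C x (g \<otimes> h) = C x g \<otimes>\<^bsub>F\<^esub> C (x #> g) h"
      "\<forall>x\<in>cosets. C x S = cS x \<and> C x U = cU x"
    using cocycle_extension[of F cS cU] F cS_closed cU_closed rel_S rel_U by blast
  then have C: "C x g \<in> carrier F"
    and C_mult: "h \<in> carrier G \<Longrightarrow> C x (g \<otimes> h) = C x g \<otimes>\<^bsub>F\<^esub> C (x #> g) h"
    if "x \<in> cosets" "g \<in> carrier G" for x g h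
    using that by simp_all
  have C_S: "C x S = cS x" and C_U: "C x U = cU x" if "x \<in> cosets" for x
    using C_all(3) that by simp_all
  have C_one: "C x \<one> = \<one>\<^bsub>F\<^esub>" if "x \<in> cosets" for x
  proof -
    have "C x \<one> \<otimes>\<^bsub>F\<^esub> C x \<one> = C x \<one>"
      using C_mult[of x \<one> \<one>] that by (simp add: coset_one)
    then show ?thesis
      using C[OF that one_closed] by (simp add: F.l_cancel_one)
  qed

  have C_sections: "(\<forall>x\<in>cosets. C H (\<alpha> x) = \<one>\<^bsub>F\<^esub>) \<and> (\<forall>x\<in>cosets. C H (\<beta> x) = inv\<^bsub>F\<^esub> e x)"
  proof (rule tree_propagate[OF tree])
    show "C H (\<alpha> H) = \<one>\<^bsub>F\<^esub>"
      using C_one ab(3) by simp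
    show "C H (\<alpha> (s x)) = \<one>\<^bsub>F\<^esub>" if "x \<in> cosets" "C H (\<alpha> x) = \<one>\<^bsub>F\<^esub>" for x
    proof (cases "s x = x")
      case False
      then have "C H (\<alpha> (s x)) = C H (\<alpha> x) \<otimes>\<^bsub>F\<^esub> C x S"
        using a[OF that(1)] C_mult[of H "\<alpha> x" S] by simp
      then show ?thesis
        using that False by (simp add: C_S cS_def)
    qed (use that in simp)
    show "C H (\<beta> (u x)) = inv\<^bsub>F\<^esub> e (u x)" if "x \<in> cosets" "C H (\<beta> x) = inv\<^bsub>F\<^esub> e x" for x
    proof (cases "u x = x")
      case False
      then have "C H (\<beta> (u x)) = C H (\<beta> x) \<otimes>\<^bsub>F\<^esub> C x U"
        using b[OF that(1)] C_mult[of H "\<beta> x" U] by simp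
      then show ?thesis
        using that False by (simp add: C_U cU_def v_def closed cancel)
    qed (use that in simp)
    show "C H (\<alpha> x) = \<one>\<^bsub>F\<^esub> \<longleftrightarrow> C H (\<beta> x) = inv\<^bsub>F\<^esub> e x" if "x \<in> T" for x
      using that ab(4) e_tree by simp
  qed
  have C_sub: "C H k \<otimes>\<^bsub>F\<^esub> C H g = C H (k \<otimes> g)" if "k \<in> H" "g \<in> carrier G" for k g
    using that C_mult[of H k g] HG H coset_join2 by simp

  \<comment> \<open>The images of the generators of \<open>F\<close> in \<open>H\<close>.\<close>
  define e' where "e' x = \<alpha> x \<otimes> inv \<beta> x" for x
  define y' where "y' x = \<alpha> x \<otimes> S \<otimes> inv \<alpha> x" for x
  define z' where "z' x = \<beta> x \<otimes> U \<otimes> inv \<beta> x" for x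
  have e'_H: "e' x \<in> H" if "x \<in> cosets" for x
    unfolding e'_def using a[OF that] b[OF that] by (intro right_quotient_in_subgroup) auto
  have y'_H: "y' x \<in> H" if "x \<in> cosets" "s x = x" for x
    unfolding y'_def using a[OF that(1)] that
    by (intro right_quotient_in_subgroup) (auto simp: coset_assoc[symmetric])
  have z'_H: "z' x \<in> H" if "x \<in> cosets" "u x = x" for x
    unfolding z'_def using b[OF that(1)] that
    by (intro right_quotient_in_subgroup) (auto simp: coset_assoc[symmetric])
  have cancel': "inv f \<otimes> (f \<otimes> g) = g" "f \<otimes> (inv f \<otimes> g) = g"
    if "f \<in> carrier G" "g \<in> carrier G" for f g
    using that by (simp_all add: m_assoc[symmetric])
  have y'_order: "y' x \<otimes> y' x = \<one>" if "x \<in> cosets" for x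
  proof -
    have "y' x \<otimes> y' x = \<alpha> x \<otimes> (S \<otimes> S) \<otimes> inv \<alpha> x"
      using a(1)[OF that] by (simp add: y'_def m_assoc cancel')
    then show ?thesis
      using a(1)[OF that] by (simp add: S_squared)
  qed
  have z'_order: "z' x \<otimes> z' x \<otimes> z' x = \<one>" if "x \<in> cosets" for x
  proof -
    have "z' x \<otimes> z' x \<otimes> z' x = \<beta> x \<otimes> (U \<otimes> U \<otimes> U) \<otimes> inv \<beta> x"
      using b(1)[OF that] by (simp add: z'_def m_assoc cancel')
    then show ?thesis
      using b(1)[OF that] by (simp add: U_cubed)
  qed
  have "\<exists>\<phi>\<in>hom F (G\<lparr>carrier := H\<rparr>). (\<forall>x\<in>cosets - T. \<phi> (e x) = e' x) \<and>
      (\<forall>x\<in>cosets. s x = x \<longrightarrow> \<phi> (y x) = y' x) \<and> (\<forall>x\<in>cosets. u x = x \<longrightarrow> \<phi> (z x) = z' x)"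
    by (rule extend) (simp_all add: e'_H y'_H z'_H y'_order z'_order)
  then obtain \<phi> where \<phi>: "\<phi> \<in> hom F (G\<lparr>carrier := H\<rparr>)"
    and \<phi>_e: "\<forall>x\<in>cosets - T. \<phi> (e x) = e' x"
    and \<phi>_y: "\<forall>x\<in>cosets. s x = x \<longrightarrow> \<phi> (y x) = y' x"
    and \<phi>_z: "\<forall>x\<in>cosets. u x = x \<longrightarrow> \<phi> (z x) = z' x"
    by blast
  interpret \<phi>: group_hom F "G\<lparr>carrier := H\<rparr>" \<phi>
    using F K \<phi> by (simp add: group_hom_def group_hom_axioms_def)
  have \<phi>_closed: "\<phi> f \<in> H" if "f \<in> carrier F" for f
    using \<phi>.hom_closed[OF that] by simp
  have \<phi>_mult: "\<phi> (f \<otimes>\<^bsub>F\<^esub> g) = \<phi> f \<otimes> \<phi> g" if "f \<in> carrier F" "g \<in> carrier F" for f g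
    using \<phi>.hom_mult[OF that] by simp
  have \<phi>_one: "\<phi> \<one>\<^bsub>F\<^esub> = \<one>"
    using \<phi>.hom_one by simp
  have \<phi>_inv: "\<phi> (inv\<^bsub>F\<^esub> f) = inv \<phi> f" if "f \<in> carrier F" for f
    using \<phi>.hom_inv[OF that] m_inv_consistent[OF H] \<phi>_closed[OF that] by simp
  have \<phi>_e_all: "\<phi> (e x) = e' x" if "x \<in> cosets" for x
  proof (cases "x \<in> T")
    case True
    then have "e' x = \<one>"
      using ab(4) b(1)[OF that] by (simp add: e'_def)
    then show ?thesis
      using True by (simp add: e_tree \<phi>_one)
  qed (use that \<phi>_e in simp)
  have \<phi>_S: "\<phi> (cS x) = \<alpha> x \<otimes> S \<otimes> inv \<alpha> (s x)" if "x \<in> cosets" for x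
  proof (cases "s x = x")
    case True
    then show ?thesis
      using that by (simp add: cS_def \<phi>_y y'_def)
  next
    case False
    then show ?thesis
      using a[OF that] by (simp add: cS_def \<phi>_one)
  qed
  have \<phi>_v: "\<phi> (v x) = \<beta> x \<otimes> U \<otimes> inv \<beta> (u x)" if "x \<in> cosets" for x
  proof (cases "u x = x")
    case True
    then show ?thesis
      using that by (simp add: v_def \<phi>_z z'_def)
  next
    case False
    then show ?thesis
      using b[OF that] by (simp add: v_def \<phi>_one)
  qed
  have \<phi>_U: "\<phi> (cU x) = \<alpha> x \<otimes> U \<otimes> inv \<alpha> (u x)" if "x \<in> cosets" for x
  proof -
    have ux: "u x \<in> cosets"
      using that by simp
    show ?thesis
      using a(1)[OF that] b(1)[OF that] a(1)[OF ux] b(1)[OF ux]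
      by (simp add: cU_def \<phi>_mult \<phi>_inv closed v_closed \<phi>_e_all \<phi>_v that e'_def inv_mult_group
          m_assoc cancel' del: \<phi>.hom_inv \<phi>.hom_mult)
  qed
  have \<phi>_C_word: "\<phi> (C x (ev w)) = \<alpha> x \<otimes> ev w \<otimes> inv \<alpha> (x #> ev w)" if "x \<in> cosets" for x w
    using that
  proof (induction w arbitrary: x)
    case Nil
    then show ?case
      using a(1)[OF Nil] by (simp add: C_one \<phi>_one coset_one)
  next
    case (Cons l w)
    define g where "g = case_letter S U l"
    have g: "g \<in> carrier G"
      by (simp add: g_def split: letter.split)
    have step: "\<phi> (C x g) = \<alpha> x \<otimes> g \<otimes> inv \<alpha> (x #> g)"
      using Cons.prems by (cases l) (simp_all add: g_def C_S C_U \<phi>_S \<phi>_U)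
    have xg: "x #> g \<in> cosets" "x #> g #> ev w \<in> cosets"
      using Cons.prems g by simp_all
    have "\<phi> (C x (g \<otimes> ev w)) = \<phi> (C x g) \<otimes> \<phi> (C (x #> g) (ev w))"
      using Cons.prems g C xg by (simp add: C_mult \<phi>_mult)
    also have "\<dots> = \<alpha> x \<otimes> (g \<otimes> ev w) \<otimes> inv \<alpha> (x #> g #> ev w)"
      using a(1)[OF Cons.prems] a(1)[OF xg(1)] a(1)[OF xg(2)] g
      by (simp add: step Cons.IH[OF xg(1)] m_assoc cancel')
    also have "x #> g #> ev w = x #> g \<otimes> ev w"
      using Cons.prems g by (simp add: coset_assoc)
    finally show ?case
      by (simp add: g_def)
  qed
  have \<phi>_C: "\<phi> (C H h) = h" if h: "h \<in> H" for h
  proof -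
    obtain w where w: "ev w = h"
      using words_generate HG[OF h] by blast
    show ?thesis
      using \<phi>_C_word[of H w] coset_join2[OF HG[OF h] H h] HG[OF h] by (simp add: w ab(3))
  qed

  have C_hom: "C H \<in> hom (G\<lparr>carrier := H\<rparr>) F"
    by (rule homI) (simp_all add: C HG C_sub)
  have C_e: "C H (e' x) = e x" if "x \<in> cosets" for x
  proof -
    have "C H (e' x) \<otimes>\<^bsub>F\<^esub> C H (\<beta> x) = C H (\<alpha> x)"
      using C_sub[OF e'_H[OF that] b(1)[OF that]] a(1)[OF that] b(1)[OF that]
      by (simp add: e'_def m_assoc)
    then have "C H (e' x) \<otimes>\<^bsub>F\<^esub> inv\<^bsub>F\<^esub> e x = \<one>\<^bsub>F\<^esub>"
      using C_sections that by simp
    then show ?thesis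
      using C[OF base_coset HG[OF e'_H[OF that]]] closed(1)[of x]
        F.inv_solve_right'[of "\<one>\<^bsub>F\<^esub>" "C H (e' x)" "e x"]
      by simp
  qed
  have C_y: "C H (y' x) = y x" if "x \<in> cosets" "s x = x" for x
  proof -
    have "C H (y' x) \<otimes>\<^bsub>F\<^esub> C H (\<alpha> x) = C H (\<alpha> x \<otimes> S)"
      using C_sub[OF y'_H[OF that] a(1)[OF that(1)]] a(1)[OF that(1)]
      by (simp add: y'_def m_assoc)
    also have "\<dots> = C H (\<alpha> x) \<otimes>\<^bsub>F\<^esub> C x S"
      using a[OF that(1)] C_mult[of H "\<alpha> x" S] by simp
    finally show ?thesis
      using C_sections that C[OF base_coset HG[OF y'_H[OF that]]] by (simp add: C_S cS_def closed)
  qed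
  have C_z: "C H (z' x) = z x" if "x \<in> cosets" "u x = x" for x
  proof -
    have "C H (z' x) \<otimes>\<^bsub>F\<^esub> C H (\<beta> x) = C H (\<beta> x \<otimes> U)"
      using C_sub[OF z'_H[OF that] b(1)[OF that(1)]] b(1)[OF that(1)]
      by (simp add: z'_def m_assoc)
    also have "\<dots> = C H (\<beta> x) \<otimes>\<^bsub>F\<^esub> C x U"
      using b[OF that(1)] C_mult[of H "\<beta> x" U] by simp
    also have "\<dots> = z x \<otimes>\<^bsub>F\<^esub> inv\<^bsub>F\<^esub> e x"
      using C_sections that by (simp add: C_U cU_def v_def closed cancel F.m_assoc)
    finally show ?thesis
      using C_sections that C[OF base_coset HG[OF z'_H[OF that]]] by (simp add: closed)
  qed
  have C_\<phi>: "C H (\<phi> f) = f" if "f \<in> carrier F" for f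
  proof (rule unique[of "\<lambda>f. C H (\<phi> f)", OF _ _ _ _ that])
    show "(\<lambda>f. C H (\<phi> f)) \<in> hom F F"
      by (rule homI) (simp_all add: C \<phi>_closed HG \<phi>_mult C_sub)
  qed (simp_all add: \<phi>_e_all C_e \<phi>_y C_y \<phi>_z C_z)
  have "bij_betw (C H) H (carrier F)"
    by (rule bij_betw_byWitness[of _ \<phi>]) (auto simp: \<phi>_C C_\<phi> C HG \<phi>_closed)
  then show ?thesis
    using C_hom by (auto simp: is_iso_def iso_def)
qed

end

section \<open>Free products of cyclic groups\<close>

text \<open>
  Here and below, \<open>integer_mod_group 0\<close> is the infinite cyclic group, so that the factors
  \<open>\<int>\<close>, \<open>\<int>\<^sub>2\<close> and \<open>\<int>\<^sub>3\<close> are treated together. For \<open>m = 1\<close> the group is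
  trivial and does not contain the integer 1; this is the reason for the recurring assumption
  \<open>m \<noteq> 1\<close>.
\<close>

lemma cyclic_hom_exists:
  assumes "group K" "a \<in> carrier K" "a [^]\<^bsub>K\<^esub> m = \<one>\<^bsub>K\<^esub>"
  shows "(\<lambda>x::int. a [^]\<^bsub>K\<^esub> x) \<in> hom (integer_mod_group m) K"
proof -
  interpret K: group K by fact
  have mod: "a [^]\<^bsub>K\<^esub> (x mod int m) = a [^]\<^bsub>K\<^esub> x" for x :: int
  proof -
    have "a [^]\<^bsub>K\<^esub> x = a [^]\<^bsub>K\<^esub> (int m * (x div int m) + x mod int m)"
      by simp
    also have "\<dots> = (a [^]\<^bsub>K\<^esub> int m) [^]\<^bsub>K\<^esub> (x div int m) \<otimes>\<^bsub>K\<^esub> a [^]\<^bsub>K\<^esub> (x mod int m)"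
      using assms(2) by (simp only: K.int_pow_mult K.int_pow_pow)
    finally show ?thesis
      using assms(2,3) by (simp add: int_pow_int)
  qed
  show ?thesis
    using assms(2) by (intro homI) (simp_all add: mod K.int_pow_mult)
qed

lemma cyclic_hom_eq:
  assumes "group K" "h \<in> hom (integer_mod_group m) K" "m \<noteq> 1" "x \<in> carrier (integer_mod_group m)"
  shows "h x = h 1 [^]\<^bsub>K\<^esub> x"
proof -
  have "1 [^]\<^bsub>integer_mod_group m\<^esub> x = x"
    using assms(4) by (auto simp: int_pow_integer_mod_group carrier_integer_mod_group split: if_splits)
  then show ?thesis
    using hom_int_pow[OF assms(2) _ group_integer_mod_group assms(1), of 1 x] assms(3) by simp
qed

definition copy_gen :: "nat \<Rightarrow> nat \<Rightarrow> nat \<Rightarrow> (nat \<times> int) list set" where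
  "copy_gen n m i = free_product_incl {..<n} (\<lambda>_. integer_mod_group m) i 1"

lemma group_free_copies: "group (free_copies n (integer_mod_group m))"
  unfolding free_copies_def by (rule group_free_product) simp

lemma hom_copy_incl:
  "i < n \<Longrightarrow> free_product_incl {..<n} (\<lambda>_. integer_mod_group m) i
    \<in> hom (integer_mod_group m) (free_copies n (integer_mod_group m))"
  unfolding free_copies_def by (rule free_product_incl_hom) simp_all

lemma copy_gen_closed: "i < n \<Longrightarrow> m \<noteq> 1 \<Longrightarrow> copy_gen n m i \<in> carrier (free_copies n (integer_mod_group m))"
  unfolding copy_gen_def by (rule hom_in_carrier[OF hom_copy_incl]) simp_all

lemma copy_gen_order:
  assumes "i < n" "m \<noteq> 1"
  shows "copy_gen n m i [^]\<^bsub>free_copies n (integer_mod_group m)\<^esub> m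
    = \<one>\<^bsub>free_copies n (integer_mod_group m)\<^esub>"
proof -
  have "1 [^]\<^bsub>integer_mod_group m\<^esub> m = \<one>\<^bsub>integer_mod_group m\<^esub>"
    by simp
  then show ?thesis
    using hom_nat_pow[OF hom_copy_incl[OF assms(1)] _ group_integer_mod_group group_free_copies, of 1 m m]
      hom_one[OF hom_copy_incl[OF assms(1)] group_integer_mod_group group_free_copies, of m] assms(2)
    by (simp add: copy_gen_def)
qed

lemma free_copies_extend:
  assumes K: "group K" and a: "\<And>i. i < n \<Longrightarrow> a i \<in> carrier K \<and> a i [^]\<^bsub>K\<^esub> m = \<one>\<^bsub>K\<^esub>"
    and m: "m \<noteq> 1"
  shows "\<exists>h\<in>hom (free_copies n (integer_mod_group m)) K. \<forall>i<n. h (copy_gen n m i) = a i"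
proof -
  interpret K: group K by fact
  obtain h where "h \<in> hom (free_copies n (integer_mod_group m)) K"
    and h: "\<forall>i\<in>{..<n}. \<forall>x\<in>carrier (integer_mod_group m).
      h (free_product_incl {..<n} (\<lambda>_. integer_mod_group m) i x) = a i [^]\<^bsub>K\<^esub> x"
    using free_product_universal[of "{..<n}" "\<lambda>_. integer_mod_group m" K "\<lambda>i x. a i [^]\<^bsub>K\<^esub> x"] K a
    by (auto simp: free_copies_def cyclic_hom_exists)
  moreover have "h (copy_gen n m i) = a i" if "i < n" for i
    using h a that m by (simp add: copy_gen_def)
  ultimately show ?thesis
    by blast
qed

text \<open>
  Both homomorphisms solve the extension problem posed by the restrictions of the first one to the
  factors, and the universal property allows one solution only.
\<close>

lemma free_product_hom_eq:
  assumes G: "\<forall>k\<in>I. group (G k)" and K: "group K"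
    and h: "h \<in> hom (free_product I G) K" "h' \<in> hom (free_product I G) K"
    and eq: "\<And>k x. k \<in> I \<Longrightarrow> x \<in> carrier (G k) \<Longrightarrow>
      h (free_product_incl I G k x) = h' (free_product_incl I G k x)"
    and z: "z \<in> carrier (free_product I G)"
  shows "h z = h' z"
proof -
  have "(\<lambda>x. h (free_product_incl I G k x)) \<in> hom (G k) K" if "k \<in> I" for k
    using hom_compose[OF free_product_incl_hom[OF G that] h(1)] by (simp add: comp_def)
  from free_product_universal[OF G K this]
  obtain g where g: "\<And>h'. h' \<in> hom (free_product I G) K \<Longrightarrow>
        (\<forall>i\<in>I. \<forall>x\<in>carrier (G i). h' (free_product_incl I G i x) = h (free_product_incl I G i x)) \<Longrightarrow>
        \<forall>z\<in>carrier (free_product I G). h' z = g z"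
    by blast
  show ?thesis
    using g[OF h(1)] g[OF h(2)] eq z by simp
qed

lemma free_copies_hom_eq:
  assumes K: "group K" and m: "m \<noteq> 1"
    and h: "h \<in> hom (free_copies n (integer_mod_group m)) K"
      "h' \<in> hom (free_copies n (integer_mod_group m)) K"
    and eq: "\<And>i. i < n \<Longrightarrow> h (copy_gen n m i) = h' (copy_gen n m i)"
    and z: "z \<in> carrier (free_copies n (integer_mod_group m))"
  shows "h z = h' z"
proof (rule free_product_hom_eq[OF _ K, of "{..<n}" "\<lambda>_. integer_mod_group m"])
  let ?incl = "free_product_incl {..<n} (\<lambda>_. integer_mod_group m)"
  fix k x assume k: "k \<in> {..<n}" and x: "x \<in> carrier (integer_mod_group m)"
  have "(\<lambda>x. g (?incl k x)) \<in> hom (integer_mod_group m) K"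
    if "g \<in> hom (free_copies n (integer_mod_group m)) K" for g
    using hom_compose[OF hom_copy_incl that] k by (simp add: comp_def)
  from cyclic_hom_eq[OF K this[OF h(1)] m x] cyclic_hom_eq[OF K this[OF h(2)] m x]
  show "h (?incl k x) = h' (?incl k x)"
    using eq k by (simp add: copy_gen_def)
qed (use h z in \<open>simp_all add: free_copies_def\<close>)

text \<open>
  A free product of free products of cyclic groups is freely generated by the generators of all the
  cyclic factors. The two levels are kept, but its universal property is stated in terms of the
  elements \<open>gen k i\<close> only. The family \<open>G\<close> is constrained on \<open>I\<close> alone, since a list of
  groups determines nothing outside its index range.
\<close>

locale free_product_of_cyclics =
  fixes I :: "'i set" and n m :: "'i \<Rightarrow> nat" and G :: "'i \<Rightarrow> (nat \<times> int) list set monoid"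
  assumes G: "k \<in> I \<Longrightarrow> G k = free_copies (n k) (integer_mod_group (m k))"
    and m: "k \<in> I \<Longrightarrow> m k \<noteq> 1"
begin

abbreviation F where "F \<equiv> free_product I G"

definition gen where "gen k i = free_product_incl I G k (copy_gen (n k) (m k) i)"

lemma group_G: "\<forall>k\<in>I. group (G k)"
  by (simp add: G group_free_copies)

lemma group_F: "group F"
  using group_G by (rule group_free_product)

lemma gen_closed: "k \<in> I \<Longrightarrow> i < n k \<Longrightarrow> gen k i \<in> carrier F"
  unfolding gen_def by (rule hom_in_carrier[OF free_product_incl_hom[OF group_G]])
    (simp_all add: G copy_gen_closed[OF _ m])

lemma gen_order:
  assumes "k \<in> I" "i < n k"
  shows "gen k i [^]\<^bsub>F\<^esub> m k = \<one>\<^bsub>F\<^esub>"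
  using hom_nat_pow[OF free_product_incl_hom[OF group_G assms(1)] _ _ group_F,
      of "copy_gen (n k) (m k) i" "m k"]
    hom_one[OF free_product_incl_hom[OF group_G assms(1)] _ group_F]
    copy_gen_order[OF assms(2) m[OF assms(1)]] copy_gen_closed[OF assms(2) m[OF assms(1)]]
  by (simp add: gen_def G[OF assms(1)] group_free_copies)

lemma gens_extend:
  assumes K: "group K"
    and a: "\<And>k i. k \<in> I \<Longrightarrow> i < n k \<Longrightarrow> a k i \<in> carrier K \<and> a k i [^]\<^bsub>K\<^esub> m k = \<one>\<^bsub>K\<^esub>"
  shows "\<exists>h\<in>hom F K. \<forall>k\<in>I. \<forall>i<n k. h (gen k i) = a k i"
proof -
  have "\<forall>k\<in>I. \<exists>f\<in>hom (G k) K. \<forall>i<n k. f (copy_gen (n k) (m k) i) = a k i"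
    using free_copies_extend[OF K] a m by (simp add: G)
  then obtain f where f: "\<And>k. k \<in> I \<Longrightarrow> f k \<in> hom (G k) K"
    "\<And>k i. k \<in> I \<Longrightarrow> i < n k \<Longrightarrow> f k (copy_gen (n k) (m k) i) = a k i"
    by metis
  obtain h where "h \<in> hom F K"
    and h: "\<forall>k\<in>I. \<forall>x\<in>carrier (G k). h (free_product_incl I G k x) = f k x"
    using free_product_universal[OF group_G K f(1)] by blast
  moreover have "h (gen k i) = a k i" if "k \<in> I" "i < n k" for k i
    using h f that by (simp add: gen_def G copy_gen_closed[OF _ m])
  ultimately show ?thesis
    by blast
qed

lemma hom_eq_on_gens:
  assumes K: "group K" and h: "h \<in> hom F K" "h' \<in> hom F K"
    and eq: "\<And>k i. k \<in> I \<Longrightarrow> i < n k \<Longrightarrow> h (gen k i) = h' (gen k i)"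
    and z: "z \<in> carrier F"
  shows "h z = h' z"
proof (rule free_product_hom_eq[OF group_G K h _ z])
  let ?incl = "free_product_incl I G"
  fix k x assume k: "k \<in> I" and x: "x \<in> carrier (G k)"
  have "(\<lambda>x. g (?incl k x)) \<in> hom (free_copies (n k) (integer_mod_group (m k))) K"
    if "g \<in> hom F K" for g
    using hom_compose[OF free_product_incl_hom[OF group_G k] that] by (simp add: comp_def G k)
  from free_copies_hom_eq[OF K m[OF k] this[OF h(1)] this[OF h(2)]]
  show "h (?incl k x) = h' (?incl k x)"
    using eq k x by (simp add: gen_def G)
qed

end

section \<open>Subgroups of finite index\<close>

lemma (in monoid) pow_two: "x \<in> carrier G \<Longrightarrow> x [^] (2 :: nat) = x \<otimes> x"
  by (simp add: numeral_2_eq_2)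

lemma (in monoid) pow_three: "x \<in> carrier G \<Longrightarrow> x [^] (3 :: nat) = x \<otimes> x \<otimes> x"
  by (simp add: numeral_3_eq_3)

context order_2_3_subgroup
begin

text \<open>
  The number of edges outside the tree is the number of cosets minus the number of edges of the
  tree, and the latter is given by the count of vertices. The rest of the proof translates the
  universal property from families indexed by cosets to the numbered factors of the free product.
\<close>

theorem finite_index_decomposition:
  assumes "finite cosets"
  shows "\<exists>n0 n2 n3 :: nat.
    G\<lparr>carrier := H\<rparr> \<cong>
      free_product_list [free_copies n0 integer_group,
                         free_copies n2 (integer_mod_group 2),
                         free_copies n3 (integer_mod_group 3)] \<and>
    int (card cosets) = 6 * int n0 + 3 * int n2 + 4 * int n3 - 6"
proof -
  obtain T where T: "tree T cosets cosets"
    using spanning_tree_exists assms by blast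
  define X2 where "X2 = {x \<in> cosets. s x = x}"
  define X3 where "X3 = {x \<in> cosets. u x = x}"
  define n0 n2 n3 where n: "n0 = card (cosets - T)" "n2 = card X2" "n3 = card X3"
  have fin: "finite (cosets - T)" "finite X2" "finite X3"
    using assms by (simp_all add: X2_def X3_def)
  obtain i0 i2 i3 where i0: "bij_betw i0 (cosets - T) {..<n0}"
    and i2: "bij_betw i2 X2 {..<n2}" and i3: "bij_betw i3 X3 {..<n3}"
    using fin by (metis n ex_bij_betw_finite_nat atLeast0LessThan)
  define Gs where "Gs = [free_copies n0 integer_group, free_copies n2 (integer_mod_group 2),
    free_copies n3 (integer_mod_group 3)]"
  have less3: "k \<in> {..<3} \<longleftrightarrow> k = 0 \<or> k = 1 \<or> k = (2 :: nat)" for k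
    by auto
  interpret P: free_product_of_cyclics "{..<3}" "\<lambda>k. [n0, n2, n3] ! k" "\<lambda>k. [0, 2, 3] ! k" "\<lambda>k. Gs ! k"
    by unfold_locales (unfold less3, auto simp: Gs_def integer_mod_group_def)
  have F: "free_product_list Gs = P.F"
    by (simp add: free_product_list_def Gs_def numeral_3_eq_3)
  interpret F: group P.F
    by (rule P.group_F)
  \<comment> \<open>The generators of the free product, indexed by cosets; where there is none, the neutral
    element serves as a placeholder, which for \<open>e\<close> on the tree is the required value.\<close>
  define e where "e x = (if x \<in> cosets - T then P.gen 0 (i0 x) else \<one>\<^bsub>P.F\<^esub>)" for x
  define y where "y x = (if x \<in> X2 then P.gen 1 (i2 x) else \<one>\<^bsub>P.F\<^esub>)" for x
  define z where "z x = (if x \<in> X3 then P.gen 2 (i3 x) else \<one>\<^bsub>P.F\<^esub>)" for x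
  have lt: "x \<in> cosets - T \<Longrightarrow> i0 x < n0" "x \<in> X2 \<Longrightarrow> i2 x < n2" "x \<in> X3 \<Longrightarrow> i3 x < n3" for x
    using i0 i2 i3 by (auto dest: bij_betwE)
  have "G\<lparr>carrier := H\<rparr> \<cong> P.F"
  proof (rule subgroup_iso_of_tree[OF T P.group_F, of e y z])
    show closed: "e x \<in> carrier P.F" "y x \<in> carrier P.F" "z x \<in> carrier P.F" for x
      using lt P.gen_closed[of 0 "i0 x"] P.gen_closed[of 1 "i2 x"] P.gen_closed[of 2 "i3 x"]
      by (simp_all add: e_def y_def z_def)
    show "e x = \<one>\<^bsub>P.F\<^esub>" if "x \<in> T" for x
      using that by (simp add: e_def)
    show "y x \<otimes>\<^bsub>P.F\<^esub> y x = \<one>\<^bsub>P.F\<^esub>" for x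
      using P.gen_order[of 1 "i2 x"] P.gen_closed[of 1 "i2 x"] lt(2)[of x]
      by (simp add: y_def F.pow_two)
    show "z x \<otimes>\<^bsub>P.F\<^esub> z x \<otimes>\<^bsub>P.F\<^esub> z x = \<one>\<^bsub>P.F\<^esub>" for x
      using P.gen_order[of 2 "i3 x"] P.gen_closed[of 2 "i3 x"] lt(3)[of x]
      by (simp add: z_def F.pow_three)
  next
    fix e' y' z' :: "'a set \<Rightarrow> 'a"
    assume e': "\<And>x. x \<in> cosets - T \<Longrightarrow> e' x \<in> H"
      and y': "\<And>x. x \<in> cosets \<Longrightarrow> s x = x \<Longrightarrow>
        y' x \<in> H \<and> y' x \<otimes> y' x = \<one>"
      and z': "\<And>x. x \<in> cosets \<Longrightarrow> u x = x \<Longrightarrow>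
        z' x \<in> H \<and> z' x \<otimes> z' x \<otimes> z' x = \<one>"
    let ?K = "G\<lparr>carrier := H\<rparr>"
    interpret K: group ?K
      using H is_group by (rule subgroup.subgroup_is_group)
    \<comment> \<open>The prescribed images, transported from cosets to the indices of the factors.\<close>
    define a where "a k i = (if k = 0 then e' (inv_into (cosets - T) i0 i)
      else if k = 1 then y' (inv_into X2 i2 i) else z' (inv_into X3 i3 i))" for k i :: nat
    have inv: "i < n0 \<Longrightarrow> inv_into (cosets - T) i0 i \<in> cosets - T"
      "i < n2 \<Longrightarrow> inv_into X2 i2 i \<in> X2" "i < n3 \<Longrightarrow> inv_into X3 i3 i \<in> X3" for i
      using i0 i2 i3 by (metis bij_betw_def inv_into_into lessThan_iff)+
    have a0: "a 0 i \<in> carrier ?K" if "i < n0" for i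
      using e'[OF inv(1)[OF that]] by (simp add: a_def)
    have a2: "a 1 i \<in> carrier ?K \<and> a 1 i \<otimes>\<^bsub>?K\<^esub> a 1 i = \<one>\<^bsub>?K\<^esub>" if "i < n2" for i
      using inv(2)[OF that] y' by (simp add: a_def X2_def)
    have a3: "a 2 i \<in> carrier ?K \<and> a 2 i \<otimes>\<^bsub>?K\<^esub> a 2 i \<otimes>\<^bsub>?K\<^esub> a 2 i = \<one>\<^bsub>?K\<^esub>"
      if "i < n3" for i
      using inv(3)[OF that] z' by (simp add: a_def X3_def)
    have a_order: "a k i \<in> carrier ?K \<and> a k i [^]\<^bsub>?K\<^esub> ([0, 2, 3] ! k :: nat) = \<one>\<^bsub>?K\<^esub>"
      if "k \<in> {..<3}" "i < [n0, n2, n3] ! k" for k i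
      using that a0[of i] a2[of i] a3[of i] unfolding less3
      by (elim disjE) (simp_all add: K.pow_two K.pow_three)
    have "\<exists>\<phi>\<in>hom P.F ?K. \<forall>k\<in>{..<3}. \<forall>i<[n0, n2, n3] ! k. \<phi> (P.gen k i) = a k i"
      using a_order by (rule P.gens_extend[OF K.group_axioms])
    then obtain \<phi> where hom: "\<phi> \<in> hom P.F ?K"
      and \<phi>: "\<forall>k\<in>{..<3}. \<forall>i<[n0, n2, n3] ! k. \<phi> (P.gen k i) = a k i"
      by blast
    have \<phi>_e: "\<phi> (e x) = e' x" if "x \<in> cosets - T" for x
      using \<phi>[rule_format, of 0 "i0 x"] that lt i0
      by (simp add: e_def a_def bij_betw_inv_into_left)
    have \<phi>_y: "\<phi> (y x) = y' x" if "x \<in> cosets" "s x = x" for x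
      using \<phi>[rule_format, of 1 "i2 x"] that lt(2)[of x] bij_betw_inv_into_left[OF i2, of x]
      by (simp add: y_def a_def X2_def)
    have \<phi>_z: "\<phi> (z x) = z' x" if "x \<in> cosets" "u x = x" for x
      using \<phi>[rule_format, of 2 "i3 x"] that lt(3)[of x] bij_betw_inv_into_left[OF i3, of x]
      by (simp add: z_def a_def X3_def)
    show "\<exists>\<phi>\<in>hom P.F ?K. (\<forall>x\<in>cosets - T. \<phi> (e x) = e' x) \<and>
        (\<forall>x\<in>cosets. s x = x \<longrightarrow> \<phi> (y x) = y' x) \<and> (\<forall>x\<in>cosets. u x = x \<longrightarrow> \<phi> (z x) = z' x)"
      using hom by (intro bexI[of _ \<phi>] conjI ballI impI) (simp_all add: \<phi>_e \<phi>_y \<phi>_z)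
  next
    fix \<theta> f
    assume \<theta>: "\<theta> \<in> hom P.F P.F" "\<And>x. x \<in> cosets - T \<Longrightarrow> \<theta> (e x) = e x"
      "\<And>x. x \<in> cosets \<Longrightarrow> s x = x \<Longrightarrow> \<theta> (y x) = y x"
      "\<And>x. x \<in> cosets \<Longrightarrow> u x = x \<Longrightarrow> \<theta> (z x) = z x" and f: "f \<in> carrier P.F"
    have id: "(\<lambda>f. f) \<in> hom P.F P.F"
      by (auto simp: hom_def)
    show "\<theta> f = f"
    proof (rule P.hom_eq_on_gens[OF P.group_F \<theta>(1) id _ f])
      fix k i assume k: "k \<in> {..<3}" and i: "i < [n0, n2, n3] ! k"
      from k consider "k = 0" | "k = 1" | "k = 2"
        unfolding less3 by blast
      then show "\<theta> (P.gen k i) = P.gen k i"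
      proof cases
        case 1
        then obtain x where "x \<in> cosets - T" "i = i0 x"
          using i i0 by (auto simp: bij_betw_def)
        then show ?thesis
          using \<theta>(2)[of x] 1 by (simp add: e_def)
      next
        case 2
        then obtain x where "x \<in> X2" "i = i2 x"
          using i i2 by (auto simp: bij_betw_def)
        then show ?thesis
          using \<theta>(3)[of x] 2 by (simp add: y_def X2_def)
      next
        case 3
        then obtain x where "x \<in> X3" "i = i3 x"
          using i i3 by (auto simp: bij_betw_def)
        then show ?thesis
          using \<theta>(4)[of x] 3 by (simp add: z_def X3_def)
      qed
    qed
  qed
  moreover have "int (card cosets) = 6 * int n0 + 3 * int n2 + 4 * int n3 - 6"
  proof -
    have "T \<subseteq> cosets"
      using tree_closed[OF T] by blast
    then have "card cosets = card T + n0"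
      using assms by (simp add: n card_Diff_subset finite_subset card_mono)
    then have "int (card cosets) = int (card T) + int n0"
      by simp
    moreover have "6 * (card T + 1) = 3 * (card cosets + n2) + 2 * (card cosets + 2 * n3)"
      using spanning_tree_count[OF assms T] by (simp only: n X2_def X3_def)
    from arg_cong[OF this, of int] have "6 * (int (card T) + 1) =
        3 * (int (card cosets) + int n2) + 2 * (int (card cosets) + 2 * int n3)"
      by (simp only: of_nat_add of_nat_mult of_nat_numeral of_nat_1)
    ultimately show ?thesis
      by (simp add: algebra_simps)
  qed
  ultimately show ?thesis
    using F unfolding Gs_def by metis
qed

end

section \<open>The modular group as a free product\<close>

fun block :: "bool \<Rightarrow> letter list" where
  "block False = [Inv, Rot]"
| "block True = [Inv, Rot, Rot]"

definition alternating :: "nat \<Rightarrow> bool list \<Rightarrow> nat \<Rightarrow> letter list" where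
  "alternating e bs d = replicate e Rot @ concat (map block bs) @ replicate d Inv"

text \<open>
  The set of words that cancel to this form is closed under adding a letter in front. The
  interesting case is \<open>Inv\<close> in front of a block: its two letters
  \<open>Inv\<close> cancel and the block dissolves into a power of \<open>Rot\<close>.
\<close>

lemma cancels_alternating: "\<exists>e<3. \<exists>bs. \<exists>d<2. cancels w (alternating e bs d)"
proof (induction w)
  case Nil
  have "cancels [] (alternating 0 [] 0)"
    by (simp add: alternating_def cancels.refl)
  then show ?case
    by (metis zero_less_numeral)
next
  case (Cons l w)
  then obtain e bs d where ed: "e < 3" "d < 2" and "cancels w (alternating e bs d)"
    by blast
  then have c: "cancels (l # w) (l # alternating e bs d)"
    by (intro cancels_Cons)
  have e: "e = 0 \<or> e = 1 \<or> e = 2" and d: "d = 0 \<or> d = 1"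
    using ed by auto
  have "\<exists>e' bs' d'. e' < 3 \<and> d' < 2 \<and> cancels (l # w) (alternating e' bs' d')"
  proof (cases l)
    case Rot
    show ?thesis
    proof (cases "e = 2")
      case True
      then have "cancels (l # w) (alternating 0 bs d)"
        using c cancels.rot[of "l # w" "[]"] by (simp add: Rot alternating_def numeral_2_eq_2)
      then show ?thesis
        using ed(2) by (metis zero_less_numeral)
    next
      case False
      then have "cancels (l # w) (alternating (Suc e) bs d)"
        using c by (simp add: Rot alternating_def)
      moreover have "Suc e < 3"
        using e False by auto
      ultimately show ?thesis
        using ed(2) by blast
    qed
  next
    case Inv
    consider "e = 1" | "e = 2" | "e = 0" "bs = []" "d = 0" | "e = 0" "bs = []" "d = 1"
      | bs' where "e = 0" "bs = False # bs'" | bs' where "e = 0" "bs = True # bs'"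
      using e d by (metis (full_types) neq_Nil_conv)
    then show ?thesis
    proof cases
      case 1
      then have "cancels (l # w) (alternating 0 (False # bs) d)"
        using c by (simp add: Inv alternating_def)
      then show ?thesis
        using ed(2) by (metis zero_less_numeral)
    next
      case 2
      then have "cancels (l # w) (alternating 0 (True # bs) d)"
        using c by (simp add: Inv alternating_def numeral_2_eq_2)
      then show ?thesis
        using ed(2) by (metis zero_less_numeral)
    next
      case 3
      then have "cancels (l # w) (alternating 0 [] 1)"
        using c by (simp add: Inv alternating_def)
      then show ?thesis
        by (metis zero_less_numeral one_less_numeral_iff semiring_norm(76))
    next
      case 4
      then have "cancels (l # w) (alternating 0 [] 0)"
        using c cancels.inv[of "l # w" "[]" "[]"] by (simp add: Inv alternating_def)
      then show ?thesis
        by (metis zero_less_numeral)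
    next
      case (5 bs')
      then have "cancels (l # w) (alternating 1 bs' d)"
        using c cancels.inv[of "l # w" "[]"] by (simp add: Inv alternating_def)
      then show ?thesis
        using ed(2) by (metis one_less_numeral_iff semiring_norm(77))
    next
      case (6 bs')
      then have "cancels (l # w) (alternating 2 bs' d)"
        using c cancels.inv[of "l # w" "[]"] by (simp add: Inv alternating_def numeral_2_eq_2)
      moreover have "2 < (3 :: nat)"
        by simp
      ultimately show ?thesis
        using ed(2) by blast
    qed
  qed
  then show ?case
    by blast
qed

definition m2 :: "int \<Rightarrow> int \<Rightarrow> int \<Rightarrow> int \<Rightarrow> int ^ 2 ^ 2" where
  "m2 a b c d = vector [vector [a, b], vector [c, d]]"

lemma m2_mult: "m2 a b c d ** m2 a' b' c' d' =
    m2 (a * a' + b * c') (a * b' + b * d') (c * a' + d * c') (c * b' + d * d')"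
  by (simp add: m2_def vec_eq_iff forall_2 matrix_matrix_mult_def sum_2)

lemma m2_uminus: "- m2 a b c d = m2 (- a) (- b) (- c) (- d)"
  by (simp add: m2_def vec_eq_iff forall_2)

lemma m2_eq_iff: "m2 a b c d = m2 a' b' c' d' \<longleftrightarrow> a = a' \<and> b = b' \<and> c = c' \<and> d = d'"
  by (auto simp: m2_def vec_eq_iff forall_2)

lemma m2_one: "mat 1 = m2 1 0 0 1"
  by (simp add: m2_def vec_eq_iff forall_2 mat_def)

lemma m2_det: "det (m2 a b c d) = a * d - b * c"
  by (simp add: m2_def det_2)

lemma m2_cases: obtains a b c d where "A = m2 a b c d"
proof
  show "A = m2 (A$1$1) (A$1$2) (A$2$1) (A$2$2)"
    by (simp add: m2_def vec_eq_iff forall_2)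
qed

text \<open>The coset of \<open>A\<close> modulo \<open>\<plusminus>1\<close>, as \<open>pm_coset\<close> shows.\<close>

definition pm :: "int ^ 2 ^ 2 \<Rightarrow> (int ^ 2 ^ 2) set" where "pm A = {A, - A}"

lemma pm_eq_iff: "pm A = pm B \<longleftrightarrow> A = B \<or> A = - B"
  by (auto simp: pm_def doubleton_eq_iff)

lemma pm_coset: "{mat 1, - mat 1} #>\<^bsub>SL2Z\<^esub> A = pm A"
proof -
  obtain a b c d where "A = m2 a b c d"
    by (rule m2_cases)
  then show ?thesis
    by (auto simp: r_coset_def pm_def SL2Z_def m2_one m2_uminus m2_mult)
qed

lemma carrier_PSL2Z: "carrier PSL2Z = pm ` {A. det A = 1}"
  by (simp add: PSL2Z_def carrier_FactGroup pm_coset) (simp add: SL2Z_def)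

lemma pm_mult:
  assumes "det A = 1" "det B = 1"
  shows "pm A \<otimes>\<^bsub>PSL2Z\<^esub> pm B = pm (A ** B)"
  using hom_mult[OF normal.r_coset_hom_Mod[OF normal_pm_one_SL2Z], of A B] assms
  by (simp add: pm_coset PSL2Z_def[symmetric]) (simp add: SL2Z_def)

lemma one_PSL2Z: "\<one>\<^bsub>PSL2Z\<^esub> = pm (mat 1)"
  by (simp add: PSL2Z_def FactGroup_def pm_def)

abbreviation "Smat \<equiv> m2 0 (- 1) 1 0"
abbreviation "Umat \<equiv> m2 0 1 (- 1) (- 1)"

abbreviation wmat :: "letter list \<Rightarrow> int ^ 2 ^ 2" where
  "wmat \<equiv> word_value SL2Z Smat Umat"

abbreviation wclass :: "letter list \<Rightarrow> (int ^ 2 ^ 2) set" where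
  "wclass \<equiv> word_value PSL2Z (pm Smat) (pm Umat)"

lemma SL2Z_simps [simp]: "A \<otimes>\<^bsub>SL2Z\<^esub> B = A ** B" "\<one>\<^bsub>SL2Z\<^esub> = mat 1" "A \<in> carrier SL2Z \<longleftrightarrow> det A = 1"
  by (simp_all add: SL2Z_def)

lemma Smat_in: "Smat \<in> carrier SL2Z" and Umat_in: "Umat \<in> carrier SL2Z"
  by (simp_all add: m2_det)

lemma pm_Smat: "pm Smat \<in> carrier PSL2Z" and pm_Umat: "pm Umat \<in> carrier PSL2Z"
  using Smat_in Umat_in by (auto simp: carrier_PSL2Z)

lemmas wmat_append = word_value_append[OF group_SL2Z Smat_in Umat_in]
lemmas wclass_append = word_value_append[OF group_PSL2Z pm_Smat pm_Umat]

lemma det_wmat: "det (wmat w) = 1"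
  using wmat_append(1)[of w] by simp

lemma wclass_eq: "wclass w = pm (wmat w)"
proof (induction w)
  case (Cons l w)
  have "case_letter (pm Smat) (pm Umat) l = pm (case_letter Smat Umat l)"
    "det (case_letter Smat Umat l) = 1"
    by (cases l; simp add: m2_det)+
  then show ?case
    by (simp add: Cons.IH pm_mult det_wmat)
qed (simp add: one_PSL2Z)

text \<open>
  Up to sign the blocks are \<open>(1, 1; 0, 1)\<close> and \<open>(1, 0; 1, 1)\<close>. Multiplying by one of them on
  the left adds one row to the other; the diagonal stays positive, and an off-diagonal entry
  becomes and stays positive.
\<close>

lemma blocks_positive:
  "\<exists>a b c d. wclass (concat (map block bs)) = pm (m2 a b c d) \<and>
    1 \<le> a \<and> 0 \<le> b \<and> 0 \<le> c \<and> 1 \<le> d \<and> (bs \<noteq> [] \<longrightarrow> 1 \<le> b + c)"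
proof (induction bs)
  case Nil
  show ?case
    by (intro exI[of _ 1] exI[of _ 0]) (simp add: one_PSL2Z m2_one)
next
  case (Cons t bs)
  then obtain a b c d where abcd: "wclass (concat (map block bs)) = pm (m2 a b c d)"
    "1 \<le> a" "0 \<le> b" "0 \<le> c" "1 \<le> d"
    by blast
  have eq: "wmat (concat (map block bs)) = m2 a b c d \<or> wmat (concat (map block bs)) = - m2 a b c d"
    using abcd(1) by (simp add: wclass_eq pm_eq_iff)
  have val: "wclass (concat (map block (t # bs))) =
      pm (wmat (block t) ** wmat (concat (map block bs)))"
    by (simp add: wclass_eq wmat_append)
  show ?case
  proof (cases t)
    case True
    have "wclass (concat (map block (t # bs))) = pm (m2 a b (a + c) (b + d))"
      unfolding val pm_eq_iff using eq by (auto simp: True m2_one m2_mult m2_uminus m2_eq_iff)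
    then show ?thesis
      using abcd by (intro exI[of _ a] exI[of _ b] exI[of _ "a + c"] exI[of _ "b + d"]) simp
  next
    case False
    have "wclass (concat (map block (t # bs))) = pm (m2 (a + c) (b + d) c d)"
      unfolding val pm_eq_iff using eq by (auto simp: False m2_one m2_mult m2_uminus m2_eq_iff)
    then show ?thesis
      using abcd by (intro exI[of _ "a + c"] exI[of _ "b + d"] exI[of _ c] exI[of _ d]) simp
  qed
qed

text \<open>
  Multiplying the matrix \<open>(p, q; r, t)\<close> of the blocks by \<open>U\<^sup>e\<close> on the left and by
  \<open>S\<^sup>d\<close> on the right leaves \<open>\<plusminus>1\<close> only when both exponents vanish: in the other five
  cases one of \<open>p\<close>, \<open>t\<close>, \<open>p + r\<close>, \<open>q + t\<close>, all positive, ends up off the diagonal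
  up to sign. If both vanish, then \<open>q = r = 0\<close>, which excludes blocks.
\<close>

lemma alternating_trivial:
  assumes "e < 3" "d < 2" "wclass (alternating e bs d) = \<one>\<^bsub>PSL2Z\<^esub>"
  shows "alternating e bs d = []"
proof -
  obtain p q r t where pqrt: "wclass (concat (map block bs)) = pm (m2 p q r t)"
    "1 \<le> p" "0 \<le> q" "0 \<le> r" "1 \<le> t" "bs \<noteq> [] \<longrightarrow> 1 \<le> q + r"
    using blocks_positive by blast
  have eq: "wmat (concat (map block bs)) = m2 p q r t \<or> wmat (concat (map block bs)) = - m2 p q r t"
    using pqrt(1) by (simp add: wclass_eq pm_eq_iff)
  have one: "wmat (replicate e Rot) ** (wmat (concat (map block bs)) ** wmat (replicate d Inv)) = mat 1
    \<or> wmat (replicate e Rot) ** (wmat (concat (map block bs)) ** wmat (replicate d Inv)) = - mat 1"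
    using assms(3) by (simp add: wclass_eq one_PSL2Z pm_eq_iff alternating_def wmat_append)
  have "e = 0 \<or> e = 1 \<or> e = 2" "d = 0 \<or> d = 1"
    using assms by auto
  then have "e = 0 \<and> d = 0 \<and> q = 0 \<and> r = 0"
    using eq one pqrt
    by (elim disjE) (auto simp: m2_one m2_mult m2_uminus m2_eq_iff numeral_2_eq_2)
  then show ?thesis
    using pqrt(6) by (simp add: alternating_def) 
qed

lemma PSL2Z_relations:
  "pm Smat \<otimes>\<^bsub>PSL2Z\<^esub> pm Smat = \<one>\<^bsub>PSL2Z\<^esub>"
  "pm Umat \<otimes>\<^bsub>PSL2Z\<^esub> pm Umat \<otimes>\<^bsub>PSL2Z\<^esub> pm Umat = \<one>\<^bsub>PSL2Z\<^esub>"
  by (simp_all add: pm_mult m2_det m2_mult one_PSL2Z pm_eq_iff m2_one m2_uminus m2_eq_iff)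

lemma PSL2Z_no_other_relations:
  assumes "wclass w = \<one>\<^bsub>PSL2Z\<^esub>"
  shows "cancels w []"
proof -
  obtain e bs d where ed: "e < 3" "d < 2" and c: "cancels w (alternating e bs d)"
    using cancels_alternating by blast
  have "wclass (alternating e bs d) = \<one>\<^bsub>PSL2Z\<^esub>"
    using cancels_word_value[OF group_PSL2Z pm_Smat pm_Umat PSL2Z_relations c] assms by simp
  with ed have "alternating e bs d = []"
    by (rule alternating_trivial)
  with c show ?thesis
    by simp
qed

lemma translation_word: "\<exists>w. wclass w = pm (m2 1 q 0 1)"
proof (induction q rule: int_induct[of _ 0])
  case base
  have "wclass [] = pm (m2 1 0 0 1)"
    by (simp add: one_PSL2Z m2_one)
  then show ?case ..
next
  case (step1 i)
  then obtain w where w: "wclass w = pm (m2 1 i 0 1)"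
    by blast
  have "wclass (w @ [Inv, Rot]) = pm (m2 1 (i + 1) 0 1)"
    by (simp add: wclass_append w) (simp add: one_PSL2Z pm_mult m2_det m2_mult m2_one add.commute)
  then show ?case ..
next
  case (step2 i)
  then obtain w where w: "wclass w = pm (m2 1 i 0 1)"
    by blast
  have "wclass (w @ [Rot, Rot, Inv]) = pm (m2 1 (i - 1) 0 1)"
    \<comment> \<open>\<open>U\<^sup>2S\<close> is the inverse translation up to sign.\<close>
    by (simp add: wclass_append w)
      (simp add: one_PSL2Z pm_mult m2_det m2_mult m2_one pm_eq_iff m2_uminus m2_eq_iff)
  then show ?case ..
qed

text \<open>
  Euclid's algorithm on the first column: \<open>SU\<close> is the translation \<open>(1, 1; 0, 1)\<close>, so a power of
  it reduces \<open>a\<close> modulo \<open>c\<close>, and \<open>S\<close> then exchanges the two rows up to sign.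
\<close>

lemma PSL2Z_generated:
  "a * d - b * c = 1 \<Longrightarrow> \<exists>w. wclass w = pm (m2 a b c d)"
proof (induction "nat \<bar>c\<bar>" arbitrary: a b c d rule: less_induct)
  case less
  show ?case
  proof (cases "c = 0")
    case True
    then have "a * d = 1"
      using less.prems by simp
    then have "a = 1 \<and> d = 1 \<or> a = -1 \<and> d = -1"
      by (rule zmult_eq_1_iff[THEN iffD1])
    then have "pm (m2 a b c d) = pm (m2 1 b 0 1) \<or> pm (m2 a b c d) = pm (m2 1 (- b) 0 1)"
      using True by (auto simp: pm_eq_iff m2_uminus m2_eq_iff)
    then show ?thesis
      using translation_word by metis
  next
    case False
    define q where "q = a div c"
    have r: "a - q * c = a mod c"
      by (simp add: q_def minus_div_mult_eq_mod)
    have "nat \<bar>a mod c\<bar> < nat \<bar>c\<bar>"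
      using False abs_mod_less[of c a] by simp
    moreover have det: "(- c) * (b - q * d) - (- d) * (a - q * c) = 1"
      using less.prems by (simp add: algebra_simps)
    ultimately obtain w where w: "wclass w = pm (m2 (- c) (- d) (a - q * c) (b - q * d))"
      using less.hyps[of "a - q * c" "- c" "b - q * d" "- d"] r by auto
    obtain t where t: "wclass t = pm (m2 1 q 0 1)"
      using translation_word by blast
    \<comment> \<open>The word \<open>w\<close> stands for \<open>S\<close> times the reduced matrix; as \<open>S\<close> is its own inverse up
      to sign, one more \<open>S\<close> and the translation by \<open>q\<close> recover the matrix.\<close>
    have "wclass (t @ [Inv] @ w) = pm (m2 1 q 0 1 ** (Smat ** m2 (- c) (- d) (a - q * c) (b - q * d)))"
      using det by (simp add: wclass_append t w) (simp add: pm_mult m2_det det_mul)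
    also have "\<dots> = pm (m2 a b c d)"
      by (simp add: m2_mult pm_eq_iff m2_uminus m2_eq_iff)
    finally show ?thesis ..
  qed
qed

theorem order_2_3_product_PSL2Z: "order_2_3_product PSL2Z (pm Smat) (pm Umat)"
proof -
  interpret group PSL2Z
    by (rule group_PSL2Z)
  show ?thesis
  proof
    show "\<exists>w. wclass w = g" if g: "g \<in> carrier PSL2Z" for g
    proof -
      obtain A where A: "det A = 1" "g = pm A"
        using g by (auto simp: carrier_PSL2Z)
      obtain a b c d where "A = m2 a b c d"
        by (rule m2_cases)
      then show ?thesis
        using A PSL2Z_generated by (simp add: m2_det)
    qed
  qed (use pm_Smat pm_Umat PSL2Z_relations PSL2Z_no_other_relations in auto)
qed

theorem corollary3p2p4:
  fixes H :: "(int ^ 2 ^ 2) set set"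
  assumes "subgroup H PSL2Z" and "finite (rcosets\<^bsub>PSL2Z\<^esub> H)"
  shows "\<exists>n0 n2 n3 :: nat.
    PSL2Z\<lparr>carrier := H\<rparr> \<cong>
      free_product_list [free_copies n0 integer_group,
                         free_copies n2 (integer_mod_group 2),
                         free_copies n3 (integer_mod_group 3)] \<and>
    int (card (rcosets\<^bsub>PSL2Z\<^esub> H)) = 6 * int n0 + 3 * int n2 + 4 * int n3 - 6"
  using order_2_3_product_PSL2Z assms
  by (intro order_2_3_subgroup.finite_index_decomposition[where S = "pm Smat" and U = "pm Umat"]
      order_2_3_subgroup.intro order_2_3_subgroup_axioms.intro)

end
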